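(* Let $d\ge 2$, $2\le l\le d$, let $\mathbf{Z}=(Z^1,\dots,Z^d)$ be a random vector with values in $[0,\infty)^d$, let $b^{(l)}:(0,\infty)\to(0,\infty)$ be a non-decreasing function with $b^{(l)}(t)\uparrow\infty$ as $t\to\infty$, and let $\alpha^{(l)}>0$. The following are equivalent. (a) The distribution of $\mathbf{Z}$ is regularly varying on $\mathbb{E}^{(l)}$ with scaling function $b^{(l)}$ and index $\alpha^{(l)}$, normalized on $\aleph^{(l)}$: there is a non-zero Radon measure $\nu^{(l)}$ on $\mathbb{E}^{(l)}$, with $\nu^{(l)}(c\,\cdot)=c^{-\alpha^{(l)}}\nu^{(l)}(\cdot)$ for all $c>0$, such that $$tP\left[\frac{\mathbf{Z}}{b^{(l)}(t)}\in\cdot\right]\stackrel{v}{\rightarrow}\nu^{(l)}(\cdot)\quad\text{in }M_+(\mathbb{E}^{(l)}),\ t\to\infty,\qquad\text{and}\qquad \nu^{(l)}(\aleph^{(l)})=1.$$ (b) There is a probability measure $S^{(l)}$ on $\delta\aleph^{(l)}$ such that $$tP\left[\left(\frac{Z^{(l)}}{b^{(l)}(t)},\frac{\mathbf{Z}}{Z^{(l)}}\right)\in\cdot\right]\stackrel{v}{\rightarrow}\nu_{\alpha^{(l)}}\times S^{(l)}(\cdot)\quad\text{in }M_+\big((0,\infty]\times\delta\aleph^{(l)}\big),\ t\to\infty.$$ Moreover, in this case the measures $\nu^{(l)}$ and $S^{(l)}$ are related by $$\nu^{(l)}\left(\left\{\mathbf{x}\in\mathbb{E}^{(l)}: x^{(l)}\ge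 r,\ \frac{\mathbf{x}}{x^{(l)}}\in\Lambda\right\}\right)=r^{-\alpha^{(l)}}S^{(l)}(\Lambda)$$ for all $r>0$ and all Borel sets $\Lambda\subset\delta\aleph^{(l)}$.
   Context: For $\mathbf{x}=(x^1,\dots,x^d)\in[0,\infty]^d$, $x^{(i)}$ denotes the $i$-th largest component, so $x^{(1)}\ge x^{(2)}\ge\dots\ge x^{(d)}$; likewise $Z^{(l)}$ is the $l$-th largest component of $\mathbf{Z}$. Set $$\mathbb{E}^{(l)}=\{\mathbf{x}\in[0,\infty]^d: x^{(l)}>0\},\quad \aleph^{(l)}=\{\mathbf{x}\in\mathbb{E}^{(l)}:x^{(l)}\ge1\},\quad \delta\aleph^{(l)}=\{\mathbf{x}\in\mathbb{E}^{(l)}:x^{(l)}=1\},$$ with topologies inherited from the compact space $[0,\infty]^d$. $M_+(\mathbb{F})$ is the set of non-negative Radon measures on a locally compact space $\mathbb{F}$, and $\stackrel{v}{\rightarrow}$ is vague convergence (convergence of integrals of non-negative continuous functions with compact support). $\nu_\alpha$ is the Pareto measure on $(0,\infty]$ given by $\nu_\alpha((r,\infty])=r^{-\alpha}$, $r>0$. In (b), the measure on the left is understood as restricted to the event $\{Z^{(l)}>0\}$ (its first coordinate takes values in $(0,\infty]$). The ratio $\mathbf{x}/x^{(l)}$ is used for $x^{(l)}<\infty$ (the set $\{x^{(l)}=\infty\}$ is $\nu^{(l)}$-null by the scaling property). *)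

theory Defs
  imports "HOL-Probability.Probability"
begin

text \<open>
  A point of \<open>[0,\<infinity>]\<^sup>d\<close> is a function \<open>'d \<Rightarrow> ennreal\<close> on a finite index type with \<open>d = CARD('d)\<close>;
  its topology (the product topology) and Borel sets are the library's.
  In \<^typ>\<open>ennreal\<close>, \<open>x / \<infinity> = 0\<close> and \<open>0 / 0 = 0\<close>.
\<close>

definition kth_largest :: "nat \<Rightarrow> ('d::finite \<Rightarrow> ennreal) \<Rightarrow> ennreal" where
  "kth_largest l x = rev (sorted_list_of_multiset (image_mset x (mset_set UNIV))) ! (l - 1)"

definition cone_E :: "nat \<Rightarrow> ('d::finite \<Rightarrow> ennreal) set" where
  "cone_E l = {x. kth_largest l x > 0}"

definition aleph :: "nat \<Rightarrow> ('d::finite \<Rightarrow> ennreal) set" where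
  "aleph l = {x \<in> cone_E l. kth_largest l x \<ge> 1}"

definition delta_aleph :: "nat \<Rightarrow> ('d::finite \<Rightarrow> ennreal) set" where
  "delta_aleph l = {x \<in> cone_E l. kth_largest l x = 1}"


text \<open>
  \<open>M\<^sub>+(F)\<close>: Borel measures on the subspace \<open>F\<close> that are finite on compact sets.  All spaces \<open>F\<close>
  used here are locally compact, Hausdorff and second countable, so regularity is automatic.
\<close>

definition radon_measures :: "'x::topological_space set \<Rightarrow> 'x measure set" where
  "radon_measures F =
     {\<mu>. sets \<mu> = sets (restrict_space borel F) \<and>
         (\<forall>K. compact K \<and> K \<subseteq> F \<longrightarrow> emeasure \<mu> K < \<infinity>)}"

text \<open>The support is the closure of \<open>{f \<noteq> 0}\<close> relative to \<open>F\<close>.\<close>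

definition Cc_plus :: "'x::topological_space set \<Rightarrow> ('x \<Rightarrow> real) set" where
  "Cc_plus F =
     {f. continuous_on F f \<and> (\<forall>x\<in>F. 0 \<le> f x) \<and> compact (F \<inter> closure {x \<in> F. f x \<noteq> 0})}"

definition vague_conv ::
    "'x::topological_space set \<Rightarrow> (real \<Rightarrow> 'x measure) \<Rightarrow> 'x measure \<Rightarrow> bool" where
  "vague_conv F \<mu> \<nu> \<longleftrightarrow>
     (\<forall>t>0. \<mu> t \<in> radon_measures F) \<and> \<nu> \<in> radon_measures F \<and>
     (\<forall>f\<in>Cc_plus F. ((\<lambda>t. \<integral>\<^sup>+ x. ennreal (f x) \<partial>\<mu> t) \<longlongrightarrow> (\<integral>\<^sup>+ x. ennreal (f x) \<partial>\<nu>)) at_top)"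

text \<open>The measure \<open>B \<mapsto> t * P[X \<in> B]\<close> on the Borel subsets \<open>B\<close> of \<open>F\<close>.\<close>

definition scaled_law ::
    "real \<Rightarrow> 'w measure \<Rightarrow> 'x::topological_space set \<Rightarrow> ('w \<Rightarrow> 'x) \<Rightarrow> 'x measure" where
  "scaled_law t P F X = scale_measure (ennreal t) (restrict_space (distr P borel X) F)"


definition is_pareto :: "real \<Rightarrow> ennreal measure \<Rightarrow> bool" where
  "is_pareto \<alpha> \<nu> \<longleftrightarrow> sets \<nu> = sets (restrict_space borel {0<..}) \<and>
     (\<forall>r>0. emeasure \<nu> {ennreal r<..} = ennreal (r powr - \<alpha>))"

definition pareto_measure :: "real \<Rightarrow> ennreal measure" where
  "pareto_measure \<alpha> = (THE \<nu>. is_pareto \<alpha> \<nu>)"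

lemma is_pareto_exists:
  assumes "\<alpha> > 0"
  shows "\<exists>\<nu>. is_pareto \<alpha> \<nu>"
proof -
  let ?g = "\<lambda>u::real. ennreal (u powr (- 1 / \<alpha>))"
  let ?L = "restrict_space lborel {0<..} :: real measure"
  let ?\<nu> = "distr ?L (restrict_space borel {0<..}) ?g"
  have "?g \<in> borel_measurable ?L"
    by (rule measurable_restrict_space1) measurable
  then have meas: "?g \<in> measurable ?L (restrict_space borel {0<..})"
    by (intro measurable_restrict_space2) (auto simp: space_restrict_space)
  have "emeasure ?\<nu> {ennreal r<..} = ennreal (r powr - \<alpha>)" if r: "r > 0" for r
  proof -
    have iff: "r < u powr (- 1 / \<alpha>) \<longleftrightarrow> u < r powr - \<alpha>" if u: "u > 0" for u
    proof -
      have "r < u powr (- 1 / \<alpha>) \<longleftrightarrow> ln r < (- 1 / \<alpha>) * ln u"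
        using r u ln_less_cancel_iff[of r "u powr (- 1 / \<alpha>)"] by (simp add: ln_powr)
      also have "\<dots> \<longleftrightarrow> ln u < - \<alpha> * ln r"
        using assms by (simp add: field_simps) linarith
      also have "\<dots> \<longleftrightarrow> u < r powr - \<alpha>"
        using r u ln_less_cancel_iff[of u "r powr - \<alpha>"] by (simp add: ln_powr)
      finally show ?thesis .
    qed
    have pre: "?g -` {ennreal r<..} \<inter> space ?L = {0<..<r powr - \<alpha>}"
      using r iff by (auto simp: space_restrict_space ennreal_less_iff)
    have "{ennreal r<..} \<in> sets (restrict_space borel {0<..})"
      by (auto simp: sets_restrict_space_iff)
    then have "emeasure ?\<nu> {ennreal r<..} = emeasure ?L {0<..<r powr - \<alpha>}"
      using meas pre by (simp add: emeasure_distr)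
    also have "\<dots> = emeasure lborel {0<..<r powr - \<alpha>}"
      by (rule emeasure_restrict_space) auto
    finally show ?thesis by simp
  qed
  then show ?thesis
    unfolding is_pareto_def by (intro exI[of _ ?\<nu>]) simp
qed

lemma is_pareto_unique:
  assumes "is_pareto \<alpha> \<mu>" "is_pareto \<alpha> \<nu>"
  shows "\<mu> = \<nu>"
proof -
  let ?\<Omega> = "{0<..} :: ennreal set"
  let ?E = "(\<lambda>r. {r<..}) ` (UNIV :: ennreal set)"
  let ?F = "\<lambda>n::nat. {ennreal (1 / Suc n)<..}"
  let ?G = "(\<inter>) ?\<Omega> ` ?E"
  have sig: "sets (restrict_space borel ?\<Omega>) = sigma_sets ?\<Omega> ?G"
  proof -
    have "sets (borel :: ennreal measure) = sigma_sets UNIV ?E"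
      by (subst borel_Ioi) simp
    moreover have "?\<Omega> \<in> sigma_sets UNIV ?E" by (intro sigma_sets.Basic) auto
    ultimately show ?thesis
      by (simp add: sets_restrict_space sigma_sets_Int)
  qed
  have UnF: "(\<Union>n. ?F n) = ?\<Omega>"
  proof (intro equalityI subsetI)
    fix x :: ennreal assume "x \<in> ?\<Omega>"
    then obtain y where y: "0 < y" "ennreal y < x"
      by (metis dense ennreal_cases ennreal_less_zero_iff greaterThan_iff not_less_iff_gr_or_eq
          top_greatest leD)
    from y(1) obtain n where "1 / real (Suc n) < y"
      using nat_approx_posE by blast
    then have "ennreal (1 / Suc n) < x"
      using y by (meson ennreal_leI le_less_trans less_imp_le)
    then show "x \<in> (\<Union>n. ?F n)" by auto
  qed (auto intro: le_less_trans[OF zero_le])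
  have F_sets: "?F n \<in> sets (restrict_space borel ?\<Omega>)" for n
    by (auto simp: sets_restrict_space_iff intro: le_less_trans[OF zero_le])
  have incF: "incseq ?F"
  proof (intro incseq_SucI subsetI)
    fix n x assume "x \<in> ?F n"
    moreover have "ennreal (1 / Suc (Suc n)) \<le> ennreal (1 / Suc n)"
      by (intro ennreal_leI) (simp add: field_simps)
    ultimately show "x \<in> ?F (Suc n)"
      unfolding greaterThan_iff by (rule le_less_trans[rotated])
  qed
  have full: "emeasure \<rho> ?\<Omega> = (SUP n. ennreal ((1 / Suc n) powr - \<alpha>))" if "is_pareto \<alpha> \<rho>" for \<rho>
  proof -
    have "emeasure \<rho> ?\<Omega> = (SUP n. emeasure \<rho> (?F n))"
      unfolding UnF[symmetric]
      using that F_sets incF by (subst SUP_emeasure_incseq) (auto simp: is_pareto_def)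
    then show ?thesis using that by (simp add: is_pareto_def)
  qed
  show ?thesis
  proof (rule measure_eqI_generator_eq[where E = ?G and \<Omega> = ?\<Omega> and A = ?F])
    show "Int_stable ?G"
    proof (rule Int_stableI)
      fix a b assume "a \<in> ?G" "b \<in> ?G"
      then obtain r s where "a = ?\<Omega> \<inter> {r<..}" "b = ?\<Omega> \<inter> {s<..}" by auto
      then have "a \<inter> b = ?\<Omega> \<inter> {max r s<..}" by auto
      then show "a \<inter> b \<in> ?G" by auto
    qed
    show "emeasure \<mu> X = emeasure \<nu> X" if "X \<in> ?G" for X
    proof -
      from that obtain r where X: "X = ?\<Omega> \<inter> {r<..}" by auto
      show ?thesis
      proof (cases r)
        case (real y)
        show ?thesis
        proof (cases "y = 0")
          case True
          then show ?thesis using X real assms full by simp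
        next
          case False
          then have "X = {ennreal y<..}"
            using X real by (auto intro: le_less_trans[OF zero_le])
          then show ?thesis using assms False real by (simp add: is_pareto_def)
        qed
      next
        case top
        then have "X = {}" using X by (auto simp: top.not_eq_extremum)
        then show ?thesis by simp
      qed
    qed
    show "range ?F \<subseteq> ?G"
    proof
      fix X assume "X \<in> range ?F"
      then obtain n where n: "X = ?F n" by auto
      then have "X = ?\<Omega> \<inter> {ennreal (1 / Suc n)<..}" by (auto intro: le_less_trans[OF zero_le])
      then show "X \<in> ?G" by blast
    qed
    show "emeasure \<mu> (?F n) \<noteq> \<infinity>" for n
      using assms(1) by (simp add: is_pareto_def)
  qed (use assms sig UnF in \<open>auto simp: is_pareto_def\<close>)
qed

lemma is_pareto_pareto_measure: "\<alpha> > 0 \<Longrightarrow> is_pareto \<alpha> (pareto_measure \<alpha>)"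
  unfolding pareto_measure_def
  by (metis is_pareto_exists is_pareto_unique theI)


definition regularly_varying ::
    "'w measure \<Rightarrow> ('w \<Rightarrow> 'd::finite \<Rightarrow> ennreal) \<Rightarrow> nat \<Rightarrow> (real \<Rightarrow> real) \<Rightarrow> real \<Rightarrow>
      ('d \<Rightarrow> ennreal) measure \<Rightarrow> bool" where
  "regularly_varying P Z l b \<alpha> \<nu> \<longleftrightarrow>
     \<nu> \<in> radon_measures (cone_E l) \<and> emeasure \<nu> (cone_E l) \<noteq> 0 \<and>
     (\<forall>c>0. \<forall>A\<in>sets \<nu>.
        emeasure \<nu> ((\<lambda>x i. ennreal c * x i) ` A) = ennreal (c powr - \<alpha>) * emeasure \<nu> A) \<and>
     vague_conv (cone_E l)
       (\<lambda>t. scaled_law t P (cone_E l) (\<lambda>\<omega> i. Z \<omega> i / ennreal (b t))) \<nu>"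

text \<open>
  If \<open>Z\<^sup>(\<^sup>l\<^sup>) = 0\<close> then the first coordinate below is \<open>0\<close>; hence restricting the law to
  \<open>(0,\<infinity>] \<times> \<delta>\<aleph>\<^sup>(\<^sup>l\<^sup>)\<close> amounts to restricting to the event \<open>Z\<^sup>(\<^sup>l\<^sup>) > 0\<close>.
\<close>

definition polar_convergence ::
    "'w measure \<Rightarrow> ('w \<Rightarrow> 'd::finite \<Rightarrow> ennreal) \<Rightarrow> nat \<Rightarrow> (real \<Rightarrow> real) \<Rightarrow> real \<Rightarrow>
      ('d \<Rightarrow> ennreal) measure \<Rightarrow> bool" where
  "polar_convergence P Z l b \<alpha> S \<longleftrightarrow>
     vague_conv ({0<..} \<times> delta_aleph l)
       (\<lambda>t. scaled_law t P ({0<..} \<times> delta_aleph l)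
          (\<lambda>\<omega>. (kth_largest l (Z \<omega>) / ennreal (b t), \<lambda>i. Z \<omega> i / kth_largest l (Z \<omega>))))
       (pareto_measure \<alpha> \<Otimes>\<^sub>M S)"

end

theory Submission
  imports Defs
begin

text \<open>
  In polar coordinates \<open>x \<mapsto> (x\<^sup>(\<^sup>l\<^sup>), x / x\<^sup>(\<^sup>l\<^sup>))\<close> homogeneity of \<open>\<nu>\<close> says that its image is a product of
  a Pareto measure and a measure on the sphere, and conversely such a product is carried back to a
  homogeneous measure.  The coordinate change is a homeomorphism only where \<open>x\<^sup>(\<^sup>l\<^sup>) < \<infinity>\<close>, so vague
  convergence cannot simply be pushed through it: a test function is first multiplied by a continuous
  cutoff that vanishes for large radii.  The error is dominated by the mass of \<open>{x. x\<^sup>(\<^sup>l\<^sup>) \<ge> n}\<close>, which is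
  controlled uniformly in the limit because the limit measure does not charge \<open>{x. x\<^sup>(\<^sup>l\<^sup>) = \<infinity>}\<close>.
  The relation between \<open>\<nu>\<close> and \<open>S\<close> follows because a vague limit on the cone is unique.
\<close>

section \<open>Order statistics of a point\<close>

text \<open>Infinity is kept as a point so that the sets of radius at least r > 0 are compact. The
  price is paid at infinite radius: division by \<infinity> gives 0, so the ratio leaves the sphere,
  and multiplying a direction by \<infinity> forgets everything except its zero coordinates. The
  same compactness supplies the remedy: one minus the cutoff is itself a test function, so the error
  obeys the very convergence that is being used. Before the limit there is no such trouble. The
  coordinates of Z are finite, hence for each t > 0 the two scaled laws are exact images of each
  other; only the passage to the limit needs an estimate. That the limit ignores infinite radii has
  a different source in each direction. Starting from S, the Pareto tail tends to 0. Starting from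
  \<nu>, the infinite level is fixed by dilations and has mass at most 1, so homogeneity makes it
  null. The product form appears when a set of directions is fixed: homogeneity then leaves a
  measure of the radius whose tail is a multiple of that of the Pareto measure, and such a measure
  is determined by its tail.\<close>

text \<open>In a decreasing list the entries satisfying an upward closed condition form an initial
  segment, so the entry at position l - 1 satisfies it exactly when the segment has length at least
  l. Facts about order statistics thereby become facts about counting coordinates.\<close>

lemma kth_largest_upclosed:
  fixes x :: "'d::finite \<Rightarrow> ennreal"
  assumes l: "1 \<le> l" "l \<le> CARD('d)"
    and up: "\<And>y z. y \<le> z \<Longrightarrow> Q y \<Longrightarrow> Q z"
  shows "Q (kth_largest l x) \<longleftrightarrow> l \<le> card {i. Q (x i)}"
proof -
  define xs where "xs = sorted_list_of_multiset (image_mset x (mset_set UNIV))"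
  define ys where "ys = rev xs"
  have mset: "mset ys = image_mset x (mset_set UNIV)"
    by (simp add: ys_def xs_def)
  have len: "length ys = CARD('d)"
    by (metis mset size_image_mset size_mset size_mset_set)
  have sorted: "sorted (rev ys)"
    by (simp add: ys_def xs_def)
  have card: "card {i. Q (x i)} = card {i. i < length ys \<and> Q (ys ! i)}"
  proof -
    have "card {i. Q (x i)} = size (filter_mset Q (image_mset x (mset_set UNIV)))"
      by (simp add: filter_mset_image_mset)
    also have "\<dots> = length (filter Q ys)"
      by (metis mset mset_filter size_mset)
    finally show ?thesis by (simp add: length_filter_conv_card)
  qed
  have kth: "kth_largest l x = ys ! (l - 1)"
    by (simp add: kth_largest_def ys_def xs_def)
  show ?thesis
  proof
    assume Q: "Q (kth_largest l x)"
    have "Q (ys ! i)" if "i < l" for i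
      using that l len by (intro up[OF _ Q]) (auto simp: kth intro!: sorted_rev_nth_mono[OF sorted])
    then have "{..<l} \<subseteq> {i. i < length ys \<and> Q (ys ! i)}"
      using l len by auto
    from card_mono[OF _ this] show "l \<le> card {i. Q (x i)}"
      using card by simp
  next
    assume le: "l \<le> card {i. Q (x i)}"
    show "Q (kth_largest l x)"
    proof (rule ccontr)
      assume nQ: "\<not> Q (kth_largest l x)"
      have "\<not> Q (ys ! i)" if "l - 1 \<le> i" "i < length ys" for i
        using up[OF sorted_rev_nth_mono[OF sorted that]] nQ kth by auto
      then have "{i. i < length ys \<and> Q (ys ! i)} \<subseteq> {..<l - 1}"
        by (auto simp: not_le[symmetric])
      from card_mono[OF _ this] show False
        using card le l by simp
    qed
  qed
qed

text \<open>The set of y with \<open>a \<le> g y\<close> is upward closed, so both sides have the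
  same lower bounds a, and an element of an order is determined by its lower bounds. Dilations and
  divisions are the instances that matter.\<close>

lemma kth_largest_mono_comp:
  fixes x :: "'d::finite \<Rightarrow> ennreal"
  assumes l: "1 \<le> l" "l \<le> CARD('d)" and "mono g"
  shows "kth_largest l (\<lambda>i. g (x i)) = g (kth_largest l x)"
proof -
  have "a \<le> kth_largest l (\<lambda>i. g (x i)) \<longleftrightarrow> a \<le> g (kth_largest l x)" for a
  proof -
    have "a \<le> g y \<Longrightarrow> y \<le> z \<Longrightarrow> a \<le> g z" for y z
      using monoD[OF \<open>mono g\<close>] order_trans by blast
    then show ?thesis
      using kth_largest_upclosed[OF l, of "\<lambda>y. a \<le> y" "\<lambda>i. g (x i)"]
        kth_largest_upclosed[OF l, of "\<lambda>y. a \<le> g y" x] order_trans by blast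
  qed
  then show ?thesis by (meson order.antisym order.refl)
qed

lemma kth_largest_const:
  assumes "1 \<le> l" "l \<le> CARD('d::finite)"
  shows "kth_largest l (\<lambda>_::'d. c) = c"
  using kth_largest_mono_comp[OF assms, of "\<lambda>_. c"] by (simp add: mono_def)

lemma kth_largest_mult:
  fixes x :: "'d::finite \<Rightarrow> ennreal"
  assumes "1 \<le> l" "l \<le> CARD('d)"
  shows "kth_largest l (\<lambda>i. c * x i) = c * kth_largest l x"
  by (rule kth_largest_mono_comp[OF assms, of "(*) c"]) (simp add: mono_def mult_left_mono)

lemma kth_largest_divide:
  fixes x :: "'d::finite \<Rightarrow> ennreal"
  assumes "1 \<le> l" "l \<le> CARD('d)"
  shows "kth_largest l (\<lambda>i. x i / c) = kth_largest l x / c"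
  using kth_largest_mult[OF assms, of "inverse c" x] by (simp add: divide_ennreal_def mult.commute)

lemma kth_largest_less_top:
  fixes x :: "'d::finite \<Rightarrow> ennreal"
  assumes l: "1 \<le> l" "l \<le> CARD('d)" and "\<forall>i. x i < \<infinity>"
  shows "kth_largest l x < \<infinity>"
proof -
  have "kth_largest l x = \<infinity> \<longleftrightarrow> l \<le> card {i. x i = \<infinity>}"
    by (rule kth_largest_upclosed[OF l]) (simp add: top_unique)
  moreover have "{i. x i = \<infinity>} = {}" using assms(3) by (auto simp: less_le)
  ultimately have "kth_largest l x \<noteq> \<infinity>" using l by (metis card.empty not_one_le_zero le_trans)
  then show ?thesis by (simp add: less_top)
qed

text \<open>Both strict comparisons with a are decided by counting coordinates. The finitely many
  coordinates lying strictly on one side of a at x stay there near x, so the counts can change only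
  in the harmless direction.\<close>

lemma continuous_on_kth_largest:
  assumes l: "1 \<le> l" "l \<le> CARD('d::finite)"
  shows "continuous_on A (kth_largest l :: ('d \<Rightarrow> ennreal) \<Rightarrow> ennreal)"
proof (rule continuous_on_subset[OF _ subset_UNIV], subst continuous_on_def, intro ballI order_tendstoI)
  fix x :: "'d \<Rightarrow> ennreal" and a
  have coord: "((\<lambda>y. y i) \<longlongrightarrow> x i) (at x)" for i
    using continuous_on_product_coordinates[of i] by (auto simp: continuous_on_def)
  have iff1: "a < kth_largest l y \<longleftrightarrow> l \<le> card {i. a < y i}" for y :: "'d \<Rightarrow> ennreal"
    by (rule kth_largest_upclosed[OF l]) auto
  have iff2: "kth_largest l y < a \<longleftrightarrow> card {i. a \<le> y i} < l" for y :: "'d \<Rightarrow> ennreal"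
    using kth_largest_upclosed[OF l, of "\<lambda>z. a \<le> z" y] by (auto simp: not_le[symmetric])
  show "eventually (\<lambda>y. a < kth_largest l y) (at x)" if "a < kth_largest l x"
  proof -
    have "eventually (\<lambda>y. \<forall>i\<in>{i. a < x i}. a < y i) (at x)"
      using order_tendstoD(1)[OF coord] by (intro eventually_ball_finite) auto
    then show ?thesis
    proof eventually_elim
      case (elim y)
      then have "card {i. a < x i} \<le> card {i. a < y i}" by (intro card_mono) auto
      with that show ?case unfolding iff1 by simp
    qed
  qed
  show "eventually (\<lambda>y. kth_largest l y < a) (at x)" if "kth_largest l x < a"
  proof -
    have "eventually (\<lambda>y. \<forall>i\<in>{i. x i < a}. y i < a) (at x)"
      using order_tendstoD(2)[OF coord] by (intro eventually_ball_finite) auto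
    then show ?thesis
    proof eventually_elim
      case (elim y)
      then have "card {i. a \<le> y i} \<le> card {i. a \<le> x i}"
        by (intro card_mono) (auto simp: not_less[symmetric])
      with that show ?case unfolding iff2 by simp
    qed
  qed
qed

section \<open>Compactness of [0,\<infinity>]^d and Borel sets of products of subspaces\<close>

lemma compact_UNIV_fun: "compact (UNIV :: ('d::finite \<Rightarrow> ennreal) set)"
proof -
  have "compact_space (euclidean :: ennreal topology)"
    using compact_UNIV[where 'a=ennreal] by (simp add: compact_space_def)
  then have "compact_space (product_topology (\<lambda>_::'d. euclidean :: ennreal topology) UNIV)"
    by (simp add: compact_space_product_topology)
  then show ?thesis
    by (simp add: euclidean_product_topology compact_space_def)
qed

text \<open>Second countability makes the Borel sets of a product the product of the Borel sets; the
  identity is then measurable in both directions between the restricted spaces.\<close>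

lemma restrict_borel_Times:
  fixes A :: "'a::second_countable_topology set" and B :: "'b::second_countable_topology set"
  shows "sets (restrict_space borel A \<Otimes>\<^sub>M restrict_space borel B) = sets (restrict_space borel (A \<times> B))"
  (is "sets ?L = sets ?R")
proof (rule antisym)
  \<comment> \<open>The identity, written as a pairing so that measurability can be checked on each
    component.\<close>
  have "(\<lambda>x. (fst x, snd x)) \<in> measurable ?R ?L"
    by (intro measurable_Pair measurable_restrict_space3) (auto simp: borel_prod[symmetric])
  from measurable_sets[OF this] show "sets ?L \<subseteq> sets ?R"
    using sets.sets_into_space[of _ ?L]
    by (auto simp: space_restrict_space space_pair_measure Int_absorb2)
  have "(\<lambda>x. (fst x, snd x)) \<in> measurable ?L (borel \<Otimes>\<^sub>M borel)"
    by (intro measurable_Pair measurable_compose[OF measurable_fst] measurable_compose[OF measurable_snd]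
         measurable_restrict_space1) auto
  then have "(\<lambda>x. x) \<in> measurable ?L ?R"
    by (intro measurable_restrict_space2) (auto simp: borel_prod space_pair_measure space_restrict_space)
  from measurable_sets[OF this] show "sets ?R \<subseteq> sets ?L"
    using sets.sets_into_space[of _ ?R]
    by (auto simp: space_restrict_space space_pair_measure Int_absorb2)
qed

section \<open>Vague convergence and radial cutoffs\<close>

text \<open>The infimum over K is attained, hence positive. A real number strictly below it is
  chosen because the minimum itself may be infinite.\<close>

lemma compact_radius_pos:
  fixes \<rho> :: "'x::topological_space \<Rightarrow> ennreal"
  assumes "compact K" "continuous_on K \<rho>" "\<And>x. x \<in> K \<Longrightarrow> 0 < \<rho> x"
  obtains r where "r > 0" "\<And>x. x \<in> K \<Longrightarrow> ennreal r \<le> \<rho> x"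
proof (cases "K = {}")
  case True
  then show ?thesis using that[of 1] by simp
next
  case False
  then obtain m where m: "m \<in> K" "\<And>x. x \<in> K \<Longrightarrow> \<rho> m \<le> \<rho> x"
    using compact_attains_inf[of "\<rho> ` K"] compact_continuous_image[OF assms(2,1)] by fastforce
  obtain q where "0 < q" "ennreal q < \<rho> m"
    using assms(3)[OF m(1)]
    by (metis dense ennreal_cases ennreal_less_zero_iff infinity_ennreal_def not_less_iff_gr_or_eq top_greatest leD)
  then show ?thesis using m(2) by (intro that[of q]) (auto intro: order_trans less_imp_le)
qed

text \<open>
  Function types have no \<open>t2_space\<close> instance, so closedness of \<open>K\<close> does not come with compactness.
\<close>

lemma Cc_plusI:
  assumes "continuous_on F f" "\<And>x. x \<in> F \<Longrightarrow> 0 \<le> f x" "compact K" "closed K" "K \<subseteq> F"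
    and "\<And>x. x \<in> F \<Longrightarrow> f x \<noteq> 0 \<Longrightarrow> x \<in> K"
  shows "f \<in> Cc_plus F"
proof -
  have "closure {x \<in> F. f x \<noteq> 0} \<subseteq> K"
    using assms by (intro closure_minimal) auto
  then have "F \<inter> closure {x \<in> F. f x \<noteq> 0} = K \<inter> closure {x \<in> F. f x \<noteq> 0}"
    using assms(5) by auto
  with assms show ?thesis by (auto simp: Cc_plus_def intro: compact_Int_closed)
qed

lemma Cc_plus_subsupport:
  assumes f: "f \<in> Cc_plus F" and g: "continuous_on F g" "\<And>x. x \<in> F \<Longrightarrow> 0 \<le> g x"
    and "\<And>x. x \<in> F \<Longrightarrow> g x \<noteq> 0 \<Longrightarrow> f x \<noteq> 0"
  shows "g \<in> Cc_plus F"
proof -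
  have "closure {x \<in> F. g x \<noteq> 0} \<subseteq> closure {x \<in> F. f x \<noteq> 0}"
    using assms(4) by (intro closure_mono) auto
  then have "F \<inter> closure {x \<in> F. g x \<noteq> 0} = F \<inter> closure {x \<in> F. f x \<noteq> 0} \<inter> closure {x \<in> F. g x \<noteq> 0}"
    by auto
  with f g show ?thesis by (auto simp: Cc_plus_def intro: compact_Int_closed)
qed

lemma Cc_plus_bounded:
  fixes F :: "'x::topological_space set"
  assumes f: "f \<in> Cc_plus F"
  obtains C where "0 \<le> C" "\<And>x. x \<in> F \<Longrightarrow> f x \<le> C"
proof -
  define K where "K = F \<inter> closure {x \<in> F. f x \<noteq> 0}"
  have "compact (f ` K)"
    using f by (intro compact_continuous_image) (auto simp: K_def Cc_plus_def intro: continuous_on_subset)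
  then obtain C where C: "\<And>x. x \<in> K \<Longrightarrow> f x \<le> C"
    by (metis bounded_imp_bdd_above bdd_above.E compact_imp_bounded imageI)
  \<comment> \<open>The maximum with 0 covers the points outside \<open>K\<close>, where
    \<open>f\<close> vanishes while \<open>C\<close> may be negative.\<close>
  have "f x \<le> max 0 C" if "x \<in> F" for x
    using C[of x] that closure_subset[of "{x \<in> F. f x \<noteq> 0}"] by (cases "f x = 0") (auto simp: K_def)
  then show ?thesis by (intro that[of "max 0 C"]) auto
qed

lemma Cc_plus_radius_pos:
  fixes \<rho> :: "'x::topological_space \<Rightarrow> ennreal"
  assumes f: "f \<in> Cc_plus F" and \<rho>: "continuous_on F \<rho>" "\<And>x. x \<in> F \<Longrightarrow> 0 < \<rho> x"
  obtains r where "r > 0" "\<And>x. x \<in> F \<Longrightarrow> f x \<noteq> 0 \<Longrightarrow> ennreal r \<le> \<rho> x"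
proof -
  define K where "K = F \<inter> closure {x \<in> F. f x \<noteq> 0}"
  obtain r where r: "r > 0" "\<And>x. x \<in> K \<Longrightarrow> ennreal r \<le> \<rho> x"
    using f \<rho> by (rule_tac K=K and \<rho>=\<rho> in compact_radius_pos)
      (auto simp: K_def Cc_plus_def intro: continuous_on_subset)
  then show ?thesis
    using closure_subset[of "{x \<in> F. f x \<noteq> 0}"] by (intro that[of r]) (auto simp: K_def)
qed

section \<open>Integrating continuous functions, and the radial cutoffs\<close>

lemma sets_radon_measures: "\<mu> \<in> radon_measures F \<Longrightarrow> sets \<mu> = sets (restrict_space borel F)"
  by (simp add: radon_measures_def)

lemma space_radon_measures: "\<mu> \<in> radon_measures F \<Longrightarrow> space \<mu> = F"
  by (auto simp: radon_measures_def space_restrict_space dest: sets_eq_imp_space_eq)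

lemma radon_measures_measurable:
  fixes f :: "'x::topological_space \<Rightarrow> real"
  assumes "\<mu> \<in> radon_measures F" "continuous_on F f"
  shows "f \<in> borel_measurable \<mu>"
  using borel_measurable_continuous_on_restrict[OF assms(2)] assms(1)
  by (simp add: radon_measures_def cong: measurable_cong_sets)

text \<open>Piecewise linear in s: constant 1 up to n, falling to 0 at n + 1. Truncated subtraction
  in \<open>ennreal\<close> gives the value 0 beyond, including at \<infinity>, and
  \<open>enn2real\<close> loses nothing because the minimum is at most 1.\<close>

definition cutoff :: "nat \<Rightarrow> ennreal \<Rightarrow> real" where
  "cutoff n s = enn2real (min 1 (of_nat (Suc n) - s))"

lemma ennreal_cutoff: "ennreal (cutoff n s) = min 1 (of_nat (Suc n) - s)"
  unfolding cutoff_def by (rule ennreal_enn2real) (auto simp: min_less_iff_disj)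

lemma cutoff_bounds: "0 \<le> cutoff n s" "cutoff n s \<le> 1"
proof -
  show "0 \<le> cutoff n s" by (simp add: cutoff_def)
  have "ennreal (cutoff n s) \<le> ennreal 1" by (simp add: ennreal_cutoff)
  then show "cutoff n s \<le> 1" by (simp del: ennreal_1)
qed

lemma cutoff_eq_1: "s \<le> of_nat n \<Longrightarrow> cutoff n s = 1"
proof -
  assume "s \<le> of_nat n"
  then have "1 \<le> of_nat (Suc n) - s"
    by (cases s) (auto simp: ennreal_of_nat_eq_real_of_nat ennreal_minus ennreal_1[symmetric]
        top_unique simp del: ennreal_1 of_nat_Suc)
  then show ?thesis by (simp add: cutoff_def min_absorb1 del: of_nat_Suc)
qed

lemma cutoff_eq_0: "of_nat (Suc n) \<le> s \<Longrightarrow> cutoff n s = 0"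
  by (simp add: cutoff_def diff_eq_0_ennreal less_top[symmetric] del: of_nat_Suc)

lemma cutoff_mono: "m \<le> n \<Longrightarrow> cutoff m s \<le> cutoff n s"
proof -
  assume "m \<le> n"
  then have "of_nat (Suc m) - s \<le> of_nat (Suc n) - s"
    by (intro ennreal_minus_mono) auto
  then have "min 1 (of_nat (Suc m) - s) \<le> min 1 (of_nat (Suc n) - s)"
    by (rule min.mono[OF order_refl])
  then show ?thesis unfolding ennreal_cutoff[symmetric] by (simp add: cutoff_bounds)
qed

lemma continuous_on_cutoff:
  assumes "continuous_on F \<rho>"
  shows "continuous_on F (\<lambda>x. cutoff n (\<rho> x))"
  unfolding continuous_on_def cutoff_def
proof
  fix x assume "x \<in> F"
  have "((\<lambda>x. min 1 (of_nat (Suc n) - \<rho> x)) \<longlongrightarrow> min 1 (of_nat (Suc n) - \<rho> x)) (at x within F)"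
    using assms \<open>x \<in> F\<close> unfolding continuous_on_def
    by (intro tendsto_min tendsto_const tendsto_diff_ennreal_general) auto
  then show "((\<lambda>x. enn2real (min 1 (of_nat (Suc n) - \<rho> x))) \<longlongrightarrow> enn2real (min 1 (of_nat (Suc n) - \<rho> x)))
    (at x within F)"
    by (intro tendsto_enn2real) (auto simp: min_less_iff_disj)
qed

text \<open>The extension of vague convergence from test functions to bounded functions that may be
  discontinuous at infinite radius. It is stated for an abstract radius \<rho> because it serves
  both directions: with the l-th largest component on the cone and with the first coordinate on the
  polar space.\<close>

lemma vague_conv_tendsto_radial:
  fixes F :: "'x::topological_space set" and \<rho> :: "'x \<Rightarrow> ennreal" and h :: "'x \<Rightarrow> real"
  assumes conv: "vague_conv F \<mu> \<nu>"
    and \<rho>: "continuous_on F \<rho>"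
    and cpt: "\<And>r. r > 0 \<Longrightarrow> compact {x \<in> F. ennreal r \<le> \<rho> x}" "\<And>r. r > 0 \<Longrightarrow> closed {x \<in> F. ennreal r \<le> \<rho> x}"
    and null: "emeasure \<nu> {x \<in> F. \<rho> x = \<infinity>} = 0"
    and h: "\<And>x. x \<in> F \<Longrightarrow> 0 \<le> h x" "\<And>x. x \<in> F \<Longrightarrow> h x \<le> C"
    and C: "0 \<le> C"
    and r: "r > 0" "\<And>x. x \<in> F \<Longrightarrow> h x \<noteq> 0 \<Longrightarrow> ennreal r \<le> \<rho> x"
    and hc: "continuous_on {x \<in> F. \<rho> x < \<infinity>} h"
  shows "((\<lambda>t. \<integral>\<^sup>+ x. ennreal (h x) \<partial>\<mu> t) \<longlongrightarrow> (\<integral>\<^sup>+ x. ennreal (h x) \<partial>\<nu>)) at_top"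
proof -
  define hn where "hn n x = cutoff n (\<rho> x) * h x" for n x
  define kn where "kn n x = 1 - cutoff n (\<rho> x)" for n x
  have \<nu>: "\<nu> \<in> radon_measures F" and \<mu>: "\<And>t. t > 0 \<Longrightarrow> \<mu> t \<in> radon_measures F"
    using conv by (auto simp: vague_conv_def)
  have hn_Cc: "hn n \<in> Cc_plus F" for n
  proof (rule Cc_plusI[OF _ _ cpt(1)[OF r(1)] cpt(2)[OF r(1)]])
    \<comment> \<open>Two relatively open sets covering \<open>F\<close>: on the first
      \<open>h\<close> is continuous, on the second the cutoff has killed it. Gluing gives
      continuity also at infinite radius.\<close>
    let ?S = "{x \<in> F. \<rho> x < \<infinity>}" and ?T = "{x \<in> F. of_nat (Suc n) < \<rho> x}"
    have F: "?S \<union> ?T = F"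
      by (auto simp: less_top[symmetric] simp del: of_nat_Suc)
    have "continuous_on (?S \<union> ?T) (hn n)"
    proof (rule continuous_on_Un_local_open)
      have "openin (top_of_set F) (F \<inter> \<rho> -` {..<\<infinity>})" "openin (top_of_set F) (F \<inter> \<rho> -` {of_nat (Suc n)<..})"
        by (intro continuous_openin_preimage_gen \<rho>; simp)+
      then show "openin (top_of_set (?S \<union> ?T)) ?S" "openin (top_of_set (?S \<union> ?T)) ?T"
        unfolding F by (auto simp: vimage_def Int_def)
      show "continuous_on ?S (hn n)"
        unfolding hn_def
        by (intro continuous_on_mult hc continuous_on_cutoff continuous_on_subset[OF \<rho>]) auto
      have "hn n x = 0" if "x \<in> ?T" for x
        using cutoff_eq_0[of n "\<rho> x"] that by (simp add: hn_def less_imp_le del: of_nat_Suc)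
      then have "continuous_on ?T (hn n) = continuous_on ?T (\<lambda>_. 0 :: real)"
        by (intro continuous_on_cong refl)
      then show "continuous_on ?T (hn n)"
        by simp
    qed
    then show "continuous_on F (hn n)" unfolding F .
  qed (use h r in \<open>auto simp: hn_def cutoff_bounds\<close>)
  \<comment> \<open>The support lies in the level set at n, which is known to be compact only for a
    positive level.\<close>
  have kn_Cc: "kn n \<in> Cc_plus F" if "n > 0" for n
  proof (rule Cc_plusI[OF _ _ cpt(1)[of "real n"] cpt(2)[of "real n"]])
    show "continuous_on F (kn n)"
      unfolding kn_def by (intro continuous_intros continuous_on_cutoff \<rho>)
    show "x \<in> {x \<in> F. ennreal (real n) \<le> \<rho> x}" if "x \<in> F" "kn n x \<noteq> 0" for x
      using that cutoff_eq_1[of "\<rho> x" n]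
      by (cases "\<rho> x \<le> of_nat n") (auto simp: kn_def ennreal_of_nat_eq_real_of_nat)
  qed (use that in \<open>auto simp: kn_def cutoff_bounds\<close>)
  have hn_le: "ennreal (hn n x) \<le> ennreal (h x)" if "x \<in> F" for n x
    unfolding hn_def using h(1)[OF that] cutoff_bounds[of n "\<rho> x"]
    by (intro ennreal_leI) (simp add: mult_left_le_one_le)
  \<comment> \<open>The gap between \<open>h\<close> and \<open>hn n\<close> is
    \<open>h x * kn n x\<close>; bounding \<open>h\<close> by \<open>C\<close> leaves a multiple of
    a test function.\<close>
  have h_le: "ennreal (h x) \<le> ennreal (hn n x) + ennreal C * ennreal (kn n x)" if "x \<in> F" for n x
  proof -
    have "h x \<le> hn n x + C * kn n x"
      using mult_right_mono[OF h(2)[OF that], of "kn n x"] cutoff_bounds[of n "\<rho> x"]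
      by (simp add: kn_def hn_def algebra_simps)
    moreover have "0 \<le> hn n x" "0 \<le> kn n x"
      using h(1)[OF that] cutoff_bounds[of n "\<rho> x"] by (auto simp: hn_def kn_def)
    ultimately show ?thesis
      using C by (simp add: ennreal_mult'[symmetric] ennreal_plus[symmetric] ennreal_leI del: ennreal_plus)
  qed
  have hn_meas: "hn n \<in> borel_measurable M" and kn_meas: "kn n \<in> borel_measurable M"
    if "M \<in> radon_measures F" for n M
    using hn_Cc[of n] continuous_on_cutoff[OF \<rho>]
    by (auto intro!: radon_measures_measurable[OF that] continuous_intros simp: Cc_plus_def kn_def)
  have conv_hn: "((\<lambda>t. \<integral>\<^sup>+ x. ennreal (hn n x) \<partial>\<mu> t) \<longlongrightarrow> (\<integral>\<^sup>+ x. ennreal (hn n x) \<partial>\<nu>)) at_top" for n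
    using conv hn_Cc by (auto simp: vague_conv_def)
  have conv_kn: "((\<lambda>t. \<integral>\<^sup>+ x. ennreal (kn n x) \<partial>\<mu> t) \<longlongrightarrow> (\<integral>\<^sup>+ x. ennreal (kn n x) \<partial>\<nu>)) at_top"
    if "n > 0" for n
    using conv kn_Cc[OF that] by (auto simp: vague_conv_def)
  have meas\<rho>: "\<rho> \<in> borel_measurable \<nu>"
    using borel_measurable_continuous_on_restrict[OF \<rho>] \<nu>
    by (simp add: radon_measures_def cong: measurable_cong_sets)
  note sp = space_radon_measures[OF \<nu>]
  show ?thesis
  proof (rule order_tendstoI)
    fix a assume a: "a < (\<integral>\<^sup>+ x. ennreal (h x) \<partial>\<nu>)"
    \<comment> \<open>Only almost everywhere: at infinite radius every \<open>hn n\<close> is 0,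
      whereas \<open>h\<close> need not vanish there.\<close>
    have "(\<integral>\<^sup>+ x. ennreal (h x) \<partial>\<nu>) = (\<integral>\<^sup>+ x. (SUP n. ennreal (hn n x)) \<partial>\<nu>)"
    proof (rule nn_integral_cong_AE)
      have "AE x in \<nu>. \<rho> x \<noteq> \<infinity>"
      proof (rule AE_I'[of "{x \<in> F. \<rho> x = \<infinity>}"])
        have "{x \<in> space \<nu>. \<rho> x = \<infinity>} \<in> sets \<nu>" using meas\<rho> by measurable
        then show "{x \<in> F. \<rho> x = \<infinity>} \<in> null_sets \<nu>" using null sp by auto
      qed (use sp in auto)
      then show "AE x in \<nu>. ennreal (h x) = (SUP n. ennreal (hn n x))"
        using AE_space
      proof eventually_elim
        case (elim x)
        then obtain n where n: "\<rho> x \<le> of_nat n"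
          using ennreal_Ex_less_of_nat[of "\<rho> x"] by (auto simp: less_top intro: less_imp_le)
        show ?case
        proof (rule antisym)
          have "ennreal (h x) = ennreal (hn n x)" by (simp add: hn_def cutoff_eq_1[OF n])
          then show "ennreal (h x) \<le> (SUP n. ennreal (hn n x))" by (auto intro: SUP_upper)
          show "(SUP n. ennreal (hn n x)) \<le> ennreal (h x)" using elim sp hn_le by (auto intro!: SUP_least)
        qed
      qed
    qed
    also have "\<dots> = (SUP n. \<integral>\<^sup>+ x. ennreal (hn n x) \<partial>\<nu>)"
    proof (rule nn_integral_monotone_convergence_SUP_AE)
      show "AE x in \<nu>. ennreal (hn n x) \<le> ennreal (hn (Suc n) x)" for n
        using cutoff_mono[of n "Suc n"] h(1) sp
        by (intro AE_I2) (auto simp: hn_def intro!: ennreal_leI mult_right_mono)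
    qed (use hn_meas[OF \<nu>] in measurable)
    finally obtain n where n: "a < (\<integral>\<^sup>+ x. ennreal (hn n x) \<partial>\<nu>)"
      using a by (auto simp: less_SUP_iff)
    have "eventually (\<lambda>t. a < (\<integral>\<^sup>+ x. ennreal (hn n x) \<partial>\<mu> t)) at_top"
      using order_tendstoD(1)[OF conv_hn n] .
    then show "eventually (\<lambda>t. a < (\<integral>\<^sup>+ x. ennreal (h x) \<partial>\<mu> t)) at_top"
      using eventually_gt_at_top[of 0]
    proof eventually_elim
      case (elim t)
      note elim(1)
      also have "(\<integral>\<^sup>+ x. ennreal (hn n x) \<partial>\<mu> t) \<le> (\<integral>\<^sup>+ x. ennreal (h x) \<partial>\<mu> t)"
        using hn_le space_radon_measures[OF \<mu>[OF elim(2)]] by (intro nn_integral_mono) auto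
      finally show ?case .
    qed
  next
    fix a assume a: "(\<integral>\<^sup>+ x. ennreal (h x) \<partial>\<nu>) < a"
    let ?A = "\<lambda>n::nat. {x \<in> F. of_nat n \<le> \<rho> x}"
    have A: "?A n \<in> sets \<nu>" for n
    proof -
      have "{x \<in> space \<nu>. of_nat n \<le> \<rho> x} \<in> sets \<nu>" using meas\<rho> by measurable
      then show ?thesis using sp by simp
    qed
    \<comment> \<open>Levels start at 1, because level 0 is all of \<open>F\<close> and may have
      infinite mass; continuity from above needs finite mass.\<close>
    have A_fin: "emeasure \<nu> (?A (Suc n)) < \<infinity>" for n
      using \<nu> cpt(1)[of "real (Suc n)"]
      by (auto simp: radon_measures_def ennreal_of_nat_eq_real_of_nat simp del: of_nat_Suc)
    have "(\<lambda>n. emeasure \<nu> (?A (Suc n))) \<longlonglongrightarrow> emeasure \<nu> (\<Inter>n. ?A (Suc n))"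
      using A A_fin
      by (intro Lim_emeasure_decseq decseq_SucI)
        (auto simp: less_top[symmetric] simp del: of_nat_Suc intro: order_trans[rotated])
    moreover have "(\<Inter>n. ?A (Suc n)) = {x \<in> F. \<rho> x = \<infinity>}"
    proof -
      have "s = \<infinity>" if "\<And>n. of_nat (Suc n) \<le> s" for s :: ennreal
      proof (rule ccontr)
        assume "s \<noteq> \<infinity>"
        then obtain n where "s < of_nat n"
          using ennreal_Ex_less_of_nat[of s] by (auto simp: less_top)
        also have "\<dots> \<le> of_nat (Suc n)" by (intro of_nat_mono) auto
        finally show False using that[of n] by simp
      qed
      then show ?thesis by (auto simp del: of_nat_Suc)
    qed
    ultimately have A0: "(\<lambda>n. emeasure \<nu> (?A (Suc n))) \<longlonglongrightarrow> 0" using null by simp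
    have "(\<integral>\<^sup>+ x. ennreal (kn (Suc n) x) \<partial>\<nu>) \<le> emeasure \<nu> (?A (Suc n))" for n
    proof -
      have "(\<integral>\<^sup>+ x. ennreal (kn (Suc n) x) \<partial>\<nu>) \<le> (\<integral>\<^sup>+ x. indicator (?A (Suc n)) x \<partial>\<nu>)"
      proof (rule nn_integral_mono)
        fix x assume "x \<in> space \<nu>"
        then show "ennreal (kn (Suc n) x) \<le> indicator (?A (Suc n)) x"
          using cutoff_eq_1[of "\<rho> x" "Suc n"] cutoff_bounds[of "Suc n" "\<rho> x"] sp
          by (cases "of_nat (Suc n) \<le> \<rho> x") (auto simp: kn_def simp del: of_nat_Suc)
      qed
      then show ?thesis unfolding nn_integral_indicator[OF A] .
    qed
    then have "(\<lambda>n. \<integral>\<^sup>+ x. ennreal (kn (Suc n) x) \<partial>\<nu>) \<longlonglongrightarrow> 0"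
      by (intro tendsto_sandwich[OF _ _ tendsto_const A0]) auto
    then have "(\<lambda>n. (\<integral>\<^sup>+ x. ennreal (h x) \<partial>\<nu>) + ennreal C * (\<integral>\<^sup>+ x. ennreal (kn (Suc n) x) \<partial>\<nu>))
        \<longlonglongrightarrow> (\<integral>\<^sup>+ x. ennreal (h x) \<partial>\<nu>) + ennreal C * 0"
      by (intro tendsto_add tendsto_const ennreal_tendsto_cmult) auto
    then have "eventually (\<lambda>n. (\<integral>\<^sup>+ x. ennreal (h x) \<partial>\<nu>) + ennreal C * (\<integral>\<^sup>+ x. ennreal (kn (Suc n) x) \<partial>\<nu>) < a)
        sequentially"
      using a by (intro order_tendstoD(2)) auto
    then obtain m where m: "(\<integral>\<^sup>+ x. ennreal (h x) \<partial>\<nu>) + ennreal C * (\<integral>\<^sup>+ x. ennreal (kn (Suc m) x) \<partial>\<nu>) < a"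
      by (auto simp: eventually_sequentially)
    \<comment> \<open>The index is fixed before t grows: the strict bound below a holds for the
      limit integrals, and it then passes to all large t.\<close>
    define n where "n = Suc m"
    have "(\<integral>\<^sup>+ x. ennreal (hn n x) \<partial>\<nu>) \<le> (\<integral>\<^sup>+ x. ennreal (h x) \<partial>\<nu>)"
      using hn_le sp by (intro nn_integral_mono) auto
    from add_right_mono[OF this] m
    have n: "(\<integral>\<^sup>+ x. ennreal (hn n x) \<partial>\<nu>) + ennreal C * (\<integral>\<^sup>+ x. ennreal (kn n x) \<partial>\<nu>) < a"
      unfolding n_def by (rule le_less_trans)
    have "((\<lambda>t. (\<integral>\<^sup>+ x. ennreal (hn n x) \<partial>\<mu> t) + ennreal C * (\<integral>\<^sup>+ x. ennreal (kn n x) \<partial>\<mu> t)) \<longlongrightarrow>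
        (\<integral>\<^sup>+ x. ennreal (hn n x) \<partial>\<nu>) + ennreal C * (\<integral>\<^sup>+ x. ennreal (kn n x) \<partial>\<nu>)) at_top"
      by (intro tendsto_add conv_hn ennreal_tendsto_cmult conv_kn) (auto simp: n_def)
    from order_tendstoD(2)[OF this n] eventually_gt_at_top[of 0]
    show "eventually (\<lambda>t. (\<integral>\<^sup>+ x. ennreal (h x) \<partial>\<mu> t) < a) at_top"
    proof eventually_elim
      case (elim t)
      have "(\<integral>\<^sup>+ x. ennreal (h x) \<partial>\<mu> t) \<le> (\<integral>\<^sup>+ x. ennreal (hn n x) + ennreal C * ennreal (kn n x) \<partial>\<mu> t)"
        using h_le space_radon_measures[OF \<mu>[OF elim(2)]] by (intro nn_integral_mono) auto
      also have "\<dots> = (\<integral>\<^sup>+ x. ennreal (hn n x) \<partial>\<mu> t) + ennreal C * (\<integral>\<^sup>+ x. ennreal (kn n x) \<partial>\<mu> t)"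
        using hn_meas[OF \<mu>[OF elim(2)], of n] kn_meas[OF \<mu>[OF elim(2)], of n]
        by (simp add: nn_integral_add nn_integral_cmult)
      also note elim(1)
      finally show ?case .
    qed
  qed
qed

section \<open>The Pareto measure\<close>

lemma UN_Ioi_inverse_Suc: "(\<Union>n. {ennreal (1 / Suc n)<..}) = {0<..}"
proof (intro equalityI subsetI)
  fix x :: ennreal assume "x \<in> {0<..}"
  then obtain y where y: "0 < y" "ennreal y < x"
    by (metis dense ennreal_cases ennreal_less_zero_iff greaterThan_iff not_less_iff_gr_or_eq
        top_greatest leD)
  from y(1) obtain n where "1 / real (Suc n) < y"
    using nat_approx_posE by blast
  then have "ennreal (1 / Suc n) < x"
    using y by (meson ennreal_leI le_less_trans less_imp_le)
  then show "x \<in> (\<Union>n. {ennreal (1 / Suc n)<..})" by auto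
qed (auto intro: le_less_trans[OF zero_le])

lemma Ioi_in_sets: "{ennreal r<..} \<in> sets (restrict_space borel {0<..})"
  by (auto simp: sets_restrict_space_iff intro: le_less_trans[OF zero_le])

lemma sets_pareto: "\<alpha> > 0 \<Longrightarrow> sets (pareto_measure \<alpha>) = sets (restrict_space borel {0<..})"
  using is_pareto_pareto_measure by (auto simp: is_pareto_def)

lemma space_pareto: "\<alpha> > 0 \<Longrightarrow> space (pareto_measure \<alpha>) = {0<..}"
  using sets_eq_imp_space_eq[OF sets_pareto] by (simp add: space_restrict_space)

lemma emeasure_pareto_Ioi: "\<alpha> > 0 \<Longrightarrow> r > 0 \<Longrightarrow> emeasure (pareto_measure \<alpha>) {ennreal r<..} = ennreal (r powr - \<alpha>)"
  using is_pareto_pareto_measure by (auto simp: is_pareto_def)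

lemma sigma_finite_pareto:
  assumes "\<alpha> > 0"
  shows "sigma_finite_measure (pareto_measure \<alpha>)"
proof
  let ?A = "range (\<lambda>n. {ennreal (1 / Suc n)<..})"
  have "\<Union>?A = space (pareto_measure \<alpha>)"
    using UN_Ioi_inverse_Suc by (simp add: space_pareto[OF assms])
  moreover have "?A \<subseteq> sets (pareto_measure \<alpha>)"
    using Ioi_in_sets by (auto simp: sets_pareto[OF assms])
  moreover have "\<forall>a\<in>?A. emeasure (pareto_measure \<alpha>) a \<noteq> \<infinity>"
    by (auto simp: emeasure_pareto_Ioi[OF assms])
  ultimately show "\<exists>A. countable A \<and> A \<subseteq> sets (pareto_measure \<alpha>) \<and> \<Union>A = space (pareto_measure \<alpha>)
      \<and> (\<forall>a\<in>A. emeasure (pareto_measure \<alpha>) a \<noteq> \<infinity>)"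
    by (intro exI[of _ ?A]) auto
qed

text \<open>Dividing by c reduces this to the uniqueness of the Pareto measure. The constant 0 has
  no inverse and is settled by exhausting (0,\<infinity>] with null tails.\<close>

lemma eq_scale_pareto:
  assumes \<alpha>: "\<alpha> > 0" and sets: "sets \<kappa> = sets (restrict_space borel {0<..})"
    and tail: "\<And>r. r > 0 \<Longrightarrow> emeasure \<kappa> {ennreal r<..} = c * ennreal (r powr - \<alpha>)" and c: "c < \<infinity>"
  shows "\<kappa> = scale_measure c (pareto_measure \<alpha>)"
proof (cases "c = 0")
  case True
  have sp: "space \<kappa> = {0<..}"
    using sets_eq_imp_space_eq[OF sets] by (simp add: space_restrict_space)
  have "emeasure \<kappa> (\<Union>n. {ennreal (1 / Suc n)<..}) = 0"
    by (intro emeasure_UN_eq_0) (auto simp: tail True sets Ioi_in_sets)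
  then have "emeasure \<kappa> (space \<kappa>) = 0"
    unfolding UN_Ioi_inverse_Suc sp .
  then have null: "emeasure \<kappa> A = 0" if "A \<in> sets \<kappa>" for A
    using emeasure_space[of \<kappa> A] by (metis le_zero_eq)
  show ?thesis
  proof (rule measure_eqI)
    show "sets \<kappa> = sets (scale_measure c (pareto_measure \<alpha>))"
      by (simp only: sets sets_pareto[OF \<alpha>] sets_scale_measure)
    show "emeasure \<kappa> A = emeasure (scale_measure c (pareto_measure \<alpha>)) A" if "A \<in> sets \<kappa>" for A
      by (simp only: null[OF that] True emeasure_scale_measure mult_zero_left)
  qed
next
  case False
  have inv: "inverse c * c = 1"
    using False c ennreal_divide_self[of c] by (simp add: divide_ennreal_def mult.commute)
  have "is_pareto \<alpha> (scale_measure (inverse c) \<kappa>)"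
    using inv by (auto simp: is_pareto_def sets tail mult.assoc[symmetric])
  then have "scale_measure (inverse c) \<kappa> = pareto_measure \<alpha>"
    using is_pareto_unique is_pareto_pareto_measure[OF \<alpha>] by blast
  then have "scale_measure c (pareto_measure \<alpha>) = scale_measure (c * inverse c) \<kappa>"
    by (metis scale_scale_measure)
  then show ?thesis using inv by (simp add: mult.commute)
qed

text \<open>The point at infinity lies in every tail, and the tails tend to 0.\<close>

lemma emeasure_pareto_top:
  assumes "\<alpha> > 0"
  shows "emeasure (pareto_measure \<alpha>) {\<infinity>} = 0"
proof -
  have "emeasure (pareto_measure \<alpha>) {\<infinity>} \<le> ennreal (r powr - \<alpha>)" if "r > 0" for r
    using assms that by (subst emeasure_pareto_Ioi[symmetric]) (auto intro!: emeasure_mono simp: sets_pareto Ioi_in_sets)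
  moreover have "((\<lambda>r. ennreal (r powr - \<alpha>)) \<longlongrightarrow> ennreal 0) at_top"
    using assms by (intro tendsto_ennrealI tendsto_neg_powr filterlim_ident) auto
  ultimately have "emeasure (pareto_measure \<alpha>) {\<infinity>} \<le> ennreal 0"
    by (intro tendsto_lowerbound[of "\<lambda>r. ennreal (r powr - \<alpha>)" _ at_top])
      (auto intro: eventually_mono[OF eventually_gt_at_top[of 0]])
  then show ?thesis by simp
qed

text \<open>The Pareto measure is specified by its open tails. A closed tail contains the open one
  at r and lies in the open ones at all s < r, and the tail function is continuous from the left at
  r.\<close>

lemma emeasure_pareto_Ici:
  assumes \<alpha>: "\<alpha> > 0" and r: "r > 0"
  shows "emeasure (pareto_measure \<alpha>) {ennreal r..} = ennreal (r powr - \<alpha>)"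
proof (rule antisym)
  have "emeasure (pareto_measure \<alpha>) {ennreal r..} \<le> ennreal (s powr - \<alpha>)" if "s > 0" "s < r" for s
    using assms that
    by (subst emeasure_pareto_Ioi[symmetric])
      (auto intro!: emeasure_mono simp: sets_pareto Ioi_in_sets elim!: less_le_trans[rotated] intro!: ennreal_lessI)
  moreover have "eventually (\<lambda>s. 0 < s \<and> s < r) (at_left r)"
    using r by (auto simp: eventually_at_left_field intro!: exI[of _ 0])
  ultimately have "eventually (\<lambda>s. emeasure (pareto_measure \<alpha>) {ennreal r..} \<le> ennreal (s powr - \<alpha>)) (at_left r)"
    by (auto elim: eventually_mono)
  moreover have "((\<lambda>s. ennreal (s powr - \<alpha>)) \<longlongrightarrow> ennreal (r powr - \<alpha>)) (at_left r)"
    using r by (intro tendsto_ennrealI tendsto_intros) auto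
  ultimately show "emeasure (pareto_measure \<alpha>) {ennreal r..} \<le> ennreal (r powr - \<alpha>)"
    by (intro tendsto_lowerbound) auto
  have "{ennreal r..} \<in> sets (pareto_measure \<alpha>)"
    using r by (auto simp: sets_pareto[OF \<alpha>] sets_restrict_space_iff intro: less_le_trans[of _ "ennreal r"])
  then show "ennreal (r powr - \<alpha>) \<le> emeasure (pareto_measure \<alpha>) {ennreal r..}"
    using assms by (subst emeasure_pareto_Ioi[symmetric]) (auto intro!: emeasure_mono)
qed

section \<open>Dilations of the Pareto measure\<close>

lemma ennreal_mult_divide_cancel:
  fixes a c :: ennreal
  assumes "0 < c" "c < \<infinity>"
  shows "c * a / c = a" "c * (a / c) = a" "c / c = 1"
proof -
  have inv: "c * inverse c = 1"
    using assms ennreal_divide_self[of c] by (simp add: divide_ennreal_def)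
  then show "c * a / c = a" "c * (a / c) = a" "c / c = 1"
    by (simp_all add: divide_ennreal_def algebra_simps)
qed

lemma ennreal_less_divide_iff:
  assumes "c > 0"
  shows "ennreal r < s / ennreal c \<longleftrightarrow> ennreal c * ennreal r < s"
proof -
  note cancel = ennreal_mult_divide_cancel[of "ennreal c"]
  have "ennreal c * ennreal r < s" if "ennreal r < s / ennreal c"
    using ennreal_mult_strict_left_mono[OF that, of "ennreal c"] assms cancel(2)[of s] by simp
  moreover have "s \<le> ennreal c * ennreal r" if "s / ennreal c \<le> ennreal r"
    using mult_left_mono[OF that, of "ennreal c"] assms cancel(2)[of s] by simp
  ultimately show ?thesis by (auto simp: not_le[symmetric])
qed

lemma measurable_divide_Ioi:
  assumes "c > 0"
  shows "(\<lambda>s. s / ennreal c) \<in> measurable (restrict_space borel {0<..}) (restrict_space borel {0<..})"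
  using assms by (intro measurable_restrict_space3 borel_measurable_divide_ennreal)
    (auto simp: ennreal_zero_less_divide)

text \<open>The preimage of the tail at r is the tail at c r, whose mass factors. This radial
  homogeneity is what the cone measure inherits.\<close>

lemma distr_pareto_divide:
  assumes \<alpha>: "\<alpha> > 0" and c: "c > 0"
  shows "distr (pareto_measure \<alpha>) (restrict_space borel {0<..}) (\<lambda>s. s / ennreal c) =
    scale_measure (ennreal (c powr - \<alpha>)) (pareto_measure \<alpha>)"
proof (rule eq_scale_pareto[OF \<alpha>])
  fix r :: real assume r: "r > 0"
  have "(\<lambda>s. s / ennreal c) -` {ennreal r<..} \<inter> {0<..} = {ennreal (c * r)<..}"
    using ennreal_less_divide_iff[OF c, of r] c r
    by (auto simp: ennreal_mult intro: le_less_trans[OF zero_le])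
  then show "emeasure (distr (pareto_measure \<alpha>) (restrict_space borel {0<..}) (\<lambda>s. s / ennreal c)) {ennreal r<..}
    = ennreal (c powr - \<alpha>) * ennreal (r powr - \<alpha>)"
    using measurable_divide_Ioi[OF c] r c
    by (subst emeasure_distr) (auto simp: Ioi_in_sets space_pareto[OF \<alpha>] emeasure_pareto_Ioi[OF \<alpha>]
        ennreal_mult'[symmetric] powr_mult cong: measurable_cong_sets sets_pareto[OF \<alpha>])
qed auto

section \<open>Polar coordinates\<close>

text \<open>
  The value at points with \<open>x\<^sup>(\<^sup>l\<^sup>) = \<infinity>\<close> is an arbitrary point of \<open>{0<..} \<times> delta_aleph l\<close> with infinite
  radius; only membership and the radius matter there, the set being null.
\<close>

definition polar_map :: "nat \<Rightarrow> ('d::finite \<Rightarrow> ennreal) \<Rightarrow> ennreal \<times> ('d \<Rightarrow> ennreal)" where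
  "polar_map l x =
     (if kth_largest l x < \<infinity> then (kth_largest l x, \<lambda>i. x i / kth_largest l x) else (\<infinity>, \<lambda>_. 1))"

text \<open>At infinite radius the convention that \<infinity> times 0 is 0 leaves only the zero
  pattern of a direction; on the sphere the radius of the image is nevertheless the correct
  one.\<close>

definition unpolar_map :: "ennreal \<times> ('d \<Rightarrow> ennreal) \<Rightarrow> 'd \<Rightarrow> ennreal" where
  "unpolar_map p = (\<lambda>i. fst p * snd p i)"

lemma cone_E_iff: "x \<in> cone_E l \<longleftrightarrow> 0 < kth_largest l x"
  by (simp add: cone_E_def)

lemma delta_aleph_iff: "x \<in> delta_aleph l \<longleftrightarrow> kth_largest l x = 1"
  by (auto simp: delta_aleph_def cone_E_def)

lemma fst_polar_map: "fst (polar_map l x) = kth_largest l x"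
  by (cases "kth_largest l x" rule: ennreal_cases) (auto simp: polar_map_def)

lemma polar_map_in:
  fixes x :: "'d::finite \<Rightarrow> ennreal"
  assumes "1 \<le> l" "l \<le> CARD('d)" "x \<in> cone_E l"
  shows "polar_map l x \<in> {0<..} \<times> delta_aleph l"
  using assms
  by (auto simp: polar_map_def cone_E_iff delta_aleph_iff kth_largest_divide kth_largest_const
      ennreal_mult_divide_cancel)

lemma kth_largest_unpolar_map:
  fixes p :: "ennreal \<times> ('d::finite \<Rightarrow> ennreal)"
  assumes "1 \<le> l" "l \<le> CARD('d)" "p \<in> {0<..} \<times> delta_aleph l"
  shows "kth_largest l (unpolar_map p) = fst p"
  using assms by (auto simp: unpolar_map_def kth_largest_mult delta_aleph_iff)

lemma unpolar_map_in:
  fixes p :: "ennreal \<times> ('d::finite \<Rightarrow> ennreal)"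
  assumes "1 \<le> l" "l \<le> CARD('d)" "p \<in> {0<..} \<times> delta_aleph l"
  shows "unpolar_map p \<in> cone_E l"
  using kth_largest_unpolar_map[OF assms] assms by (auto simp: cone_E_iff)

lemma polar_unpolar_map:
  fixes p :: "ennreal \<times> ('d::finite \<Rightarrow> ennreal)"
  assumes "1 \<le> l" "l \<le> CARD('d)" "p \<in> {0<..} \<times> delta_aleph l" "fst p < \<infinity>"
  shows "polar_map l (unpolar_map p) = p"
  using assms kth_largest_unpolar_map[OF assms(1-3)]
  by (auto simp: polar_map_def unpolar_map_def prod_eq_iff ennreal_mult_divide_cancel)

lemma unpolar_polar_map:
  assumes "0 < kth_largest l x" "kth_largest l x < \<infinity>"
  shows "unpolar_map (polar_map l x) = x"
  using assms by (auto simp: polar_map_def unpolar_map_def ennreal_mult_divide_cancel)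

lemma tendsto_coordinate:
  fixes f :: "'a \<Rightarrow> 'i \<Rightarrow> 'b::topological_space"
  assumes "(f \<longlongrightarrow> y) G"
  shows "((\<lambda>x. f x i) \<longlongrightarrow> y i) G"
  using continuous_on_tendsto_compose[OF continuous_on_product_coordinates assms] by simp

lemma continuous_on_polar_map:
  assumes "1 \<le> l" "l \<le> CARD('d::finite)"
  shows "continuous_on {x \<in> cone_E l. kth_largest l x < \<infinity>}
    (polar_map l :: ('d \<Rightarrow> ennreal) \<Rightarrow> _)"
proof -
  let ?S = "{x \<in> cone_E l. kth_largest l x < \<infinity>} :: ('d \<Rightarrow> ennreal) set"
  have kth: "continuous_on ?S (kth_largest l)"
    by (rule continuous_on_kth_largest[OF assms])
  have "continuous_on ?S (\<lambda>x i. x i / kth_largest l x)"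
  proof (rule continuous_on_coordinatewise_then_product)
    fix i
    show "continuous_on ?S (\<lambda>x. x i / kth_largest l x)"
      unfolding continuous_on_def divide_ennreal_def
    proof
      fix x :: "'d \<Rightarrow> ennreal" assume x: "x \<in> ?S"
      have "((\<lambda>x. inverse (kth_largest l x)) \<longlongrightarrow> inverse (kth_largest l x)) (at x within ?S)"
        using continuous_on_inverse_ennreal[OF kth] x unfolding continuous_on_def by blast
      \<comment> \<open>Multiplication in \<open>ennreal\<close> is discontinuous only where 0 meets
        \<infinity>. Since this factor is neither, the coordinate \<open>x i\<close> may take any
        value, \<infinity> included.\<close>
      moreover have "inverse (kth_largest l x) \<noteq> 0" "inverse (kth_largest l x) \<noteq> \<infinity>"
        using x by (auto simp: cone_E_iff)
      ultimately show "((\<lambda>x. x i * inverse (kth_largest l x)) \<longlongrightarrow> x i * inverse (kth_largest l x)) (at x within ?S)"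
        by (intro tendsto_mult_ennreal[OF tendsto_coordinate[OF tendsto_ident_at]]) simp_all
    qed
  qed
  then have "continuous_on ?S (\<lambda>x. (kth_largest l x, \<lambda>i. x i / kth_largest l x))"
    by (intro continuous_on_Pair kth)
  then show ?thesis
    by (rule continuous_on_eq) (simp add: polar_map_def)
qed

lemma continuous_on_unpolar_map:
  "continuous_on {p \<in> {0<..} \<times> T. fst p < \<infinity>} (unpolar_map :: _ \<Rightarrow> 'd \<Rightarrow> ennreal)"
proof (rule continuous_on_coordinatewise_then_product)
  fix i
  let ?S = "{p \<in> {0<..} \<times> T. fst p < \<infinity>} :: (ennreal \<times> ('d \<Rightarrow> ennreal)) set"
  show "continuous_on ?S (\<lambda>p. unpolar_map p i)"
    unfolding continuous_on_def unpolar_map_def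
    by (intro ballI tendsto_mult_ennreal tendsto_coordinate[OF tendsto_snd[OF tendsto_ident_at]]
        tendsto_fst tendsto_ident_at) auto
qed

section \<open>Measurability of the coordinate change and compact level sets\<close>

lemma borel_measurable_kth_largest:
  assumes "1 \<le> l" "l \<le> CARD('d::finite)"
  shows "(kth_largest l :: ('d \<Rightarrow> ennreal) \<Rightarrow> ennreal) \<in> borel_measurable borel"
  by (intro borel_measurable_continuous_onI continuous_on_kth_largest assms)

lemma borel_measurable_coordinate:
  "(\<lambda>x. x i) \<in> borel_measurable (borel :: ('i \<Rightarrow> 'b::topological_space) measure)"
  by (intro borel_measurable_continuous_onI continuous_on_product_coordinates)

lemma sets_cone_E:
  assumes "1 \<le> l" "l \<le> CARD('d::finite)"
  shows "(cone_E l :: ('d \<Rightarrow> ennreal) set) \<in> sets borel"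
proof -
  have "kth_largest l -` {0<..} \<inter> space borel \<in> sets (borel :: ('d \<Rightarrow> ennreal) measure)"
    by (intro measurable_sets[OF borel_measurable_kth_largest[OF assms]]) auto
  then show ?thesis by (simp add: cone_E_def vimage_def)
qed

lemma sets_delta_aleph:
  assumes "1 \<le> l" "l \<le> CARD('d::finite)"
  shows "(delta_aleph l :: ('d \<Rightarrow> ennreal) set) \<in> sets borel"
proof -
  have "kth_largest l -` {1} \<inter> space borel \<in> sets (borel :: ('d \<Rightarrow> ennreal) measure)"
    by (intro measurable_sets[OF borel_measurable_kth_largest[OF assms]]) auto
  moreover have "(delta_aleph l :: ('d \<Rightarrow> ennreal) set) = kth_largest l -` {1} \<inter> space borel"
    by (auto simp: delta_aleph_iff)
  ultimately show ?thesis by simp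
qed

lemma sets_polar_space:
  assumes "1 \<le> l" "l \<le> CARD('d::finite)"
  shows "({0<..} \<times> delta_aleph l :: (ennreal \<times> ('d \<Rightarrow> ennreal)) set) \<in> sets borel"
  unfolding borel_prod[symmetric] by (intro pair_measureI sets_delta_aleph assms) simp

lemma measurable_polar_map:
  assumes l: "1 \<le> l" "l \<le> CARD('d::finite)"
  shows "(polar_map l :: ('d \<Rightarrow> ennreal) \<Rightarrow> _) \<in>
    measurable (restrict_space borel (cone_E l)) (restrict_space borel ({0<..} \<times> delta_aleph l))"
proof (rule measurable_restrict_space3)
  note [measurable] = borel_measurable_kth_largest[OF l]
  have "(\<lambda>x i. x i / kth_largest l x) \<in> measurable borel (borel :: ('d \<Rightarrow> ennreal) measure)"
    by (intro measurable_coordinatewise_then_product borel_measurable_divide_ennreal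
        borel_measurable_coordinate borel_measurable_kth_largest l)
  then have "(\<lambda>x. (kth_largest l x, \<lambda>i. x i / kth_largest l x)) \<in>
      borel_measurable (borel :: ('d \<Rightarrow> ennreal) measure)"
    unfolding borel_prod[symmetric] by (intro measurable_Pair borel_measurable_kth_largest l)
  moreover have "{x \<in> space borel. kth_largest l x < \<infinity>} \<in> sets (borel :: ('d \<Rightarrow> ennreal) measure)"
    by measurable
  ultimately show "(polar_map l :: ('d \<Rightarrow> ennreal) \<Rightarrow> _) \<in> borel_measurable borel"
    unfolding polar_map_def by (intro measurable_If measurable_const) auto
qed (use polar_map_in[OF l] in blast)

lemma measurable_unpolar_map:
  assumes l: "1 \<le> l" "l \<le> CARD('d::finite)"
  shows "(unpolar_map :: _ \<Rightarrow> 'd \<Rightarrow> ennreal) \<in>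
    measurable (restrict_space borel ({0<..} \<times> delta_aleph l)) (restrict_space borel (cone_E l))"
proof (rule measurable_restrict_space3)
  have "(\<lambda>p. unpolar_map p i) \<in> borel_measurable (borel \<Otimes>\<^sub>M (borel :: ('d \<Rightarrow> ennreal) measure))" for i
    unfolding unpolar_map_def
    by (intro borel_measurable_times_ennreal measurable_fst
        measurable_compose[OF measurable_snd borel_measurable_coordinate])
  then show "(unpolar_map :: _ \<Rightarrow> 'd \<Rightarrow> ennreal) \<in> borel_measurable borel"
    unfolding borel_prod by (rule measurable_coordinatewise_then_product)
qed (use unpolar_map_in[OF l] in blast)

text \<open>A radius at least r > 0 already forces membership in the cone, so the level set is
  closed in the whole compact space [0,\<infinity>]^d and not merely in the cone.\<close>

lemma compact_cone_E_level:
  assumes l: "1 \<le> l" "l \<le> CARD('d::finite)" and "0 < r"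
  shows "compact {x \<in> cone_E l :: ('d \<Rightarrow> ennreal) set. ennreal r \<le> kth_largest l x}"
    and "closed {x \<in> cone_E l :: ('d \<Rightarrow> ennreal) set. ennreal r \<le> kth_largest l x}"
proof -
  have "closed {x :: 'd \<Rightarrow> ennreal. ennreal r \<le> kth_largest l x}"
    using continuous_on_kth_largest[OF l, of UNIV] by (intro closed_Collect_le) auto
  moreover have "{x \<in> cone_E l :: ('d \<Rightarrow> ennreal) set. ennreal r \<le> kth_largest l x}
      = UNIV \<inter> {x. ennreal r \<le> kth_largest l x}"
    using \<open>0 < r\<close> by (auto simp: cone_E_iff intro: less_le_trans[of _ "ennreal r"])
  ultimately show "compact {x \<in> cone_E l :: ('d \<Rightarrow> ennreal) set. ennreal r \<le> kth_largest l x}"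
      "closed {x \<in> cone_E l :: ('d \<Rightarrow> ennreal) set. ennreal r \<le> kth_largest l x}"
    using compact_Int_closed[OF compact_UNIV_fun] by (metis, simp)
qed

text \<open>The sphere is closed in [0,\<infinity>]^d and hence compact, and so is the interval of
  radii because it includes \<infinity>.\<close>

lemma compact_polar_level:
  assumes l: "1 \<le> l" "l \<le> CARD('d::finite)" and "0 < r"
  shows "compact {p \<in> {0<..} \<times> delta_aleph l :: (ennreal \<times> ('d \<Rightarrow> ennreal)) set. ennreal r \<le> fst p}"
    and "closed {p \<in> {0<..} \<times> delta_aleph l :: (ennreal \<times> ('d \<Rightarrow> ennreal)) set. ennreal r \<le> fst p}"
proof -
  have "closed {x :: 'd \<Rightarrow> ennreal. kth_largest l x = 1}"
    using continuous_on_kth_largest[OF l, of UNIV] by (intro closed_Collect_eq) auto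
  moreover have "delta_aleph l = UNIV \<inter> {x :: 'd \<Rightarrow> ennreal. kth_largest l x = 1}"
    by (auto simp: delta_aleph_iff)
  ultimately have "compact (delta_aleph l :: ('d \<Rightarrow> ennreal) set)" "closed (delta_aleph l :: ('d \<Rightarrow> ennreal) set)"
    using compact_Int_closed[OF compact_UNIV_fun] by (metis, simp)
  moreover have "compact {ennreal r..}"
    by (simp add: compact_eq_closed)
  ultimately have "compact ({ennreal r..} \<times> delta_aleph l :: (ennreal \<times> ('d \<Rightarrow> ennreal)) set)"
      "closed ({ennreal r..} \<times> delta_aleph l :: (ennreal \<times> ('d \<Rightarrow> ennreal)) set)"
    by (auto intro!: compact_Times closed_Times)
  moreover have "{p \<in> {0<..} \<times> delta_aleph l. ennreal r \<le> fst p} =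
      ({ennreal r..} \<times> delta_aleph l :: (ennreal \<times> ('d \<Rightarrow> ennreal)) set)"
    using \<open>0 < r\<close> by (auto intro: less_le_trans[of _ "ennreal r"])
  ultimately show "compact {p \<in> {0<..} \<times> delta_aleph l :: (ennreal \<times> ('d \<Rightarrow> ennreal)) set. ennreal r \<le> fst p}"
      "closed {p \<in> {0<..} \<times> delta_aleph l :: (ennreal \<times> ('d \<Rightarrow> ennreal)) set. ennreal r \<le> fst p}"
    by simp_all
qed

section \<open>The scaled laws as Radon measures\<close>

lemma finite_measure_radon:
  assumes "finite_measure \<mu>" "sets \<mu> = sets (restrict_space borel F)"
  shows "\<mu> \<in> radon_measures F"
  unfolding radon_measures_def
proof (intro CollectI conjI allI impI)
  show "emeasure \<mu> K < \<infinity>" for K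
    using finite_measure.emeasure_finite[OF assms(1), of K] by (simp add: less_le)
qed fact

lemma sets_scaled_law: "sets (scaled_law t P F X) = sets (restrict_space borel F)"
  by (simp add: scaled_law_def sets_restrict_space)

lemma scaled_law_radon:
  assumes "prob_space P" "X \<in> borel_measurable P" "F \<in> sets borel" "0 \<le> t"
  shows "scaled_law t P F X \<in> radon_measures F"
proof (intro finite_measure_radon finite_measureI sets_scaled_law)
  interpret D: prob_space "distr P borel X"
    by (rule prob_space.prob_space_distr[OF assms(1,2)])
  show "emeasure (scaled_law t P F X) (space (scaled_law t P F X)) \<noteq> \<infinity>"
  proof -
    have "emeasure (scaled_law t P F X) (space (scaled_law t P F X)) = ennreal t * emeasure (distr P borel X) F"
      using assms(3) by (simp add: scaled_law_def space_scale_measure space_restrict_space emeasure_restrict_space)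
    also have "\<dots> < \<infinity>"
      using D.emeasure_finite[of F] by (simp add: less_le ennreal_mult_eq_top_iff)
    finally show ?thesis by simp
  qed
qed

text \<open>Moves integrals to the probability space, where the cone law and the polar law can be
  compared outcome by outcome.\<close>

lemma nn_integral_scaled_law:
  assumes X: "X \<in> borel_measurable P" and F: "F \<in> sets borel" and f: "f \<in> borel_measurable (restrict_space borel F)"
  shows "(\<integral>\<^sup>+ x. f x \<partial>scaled_law t P F X) = ennreal t * (\<integral>\<^sup>+ \<omega>. f (X \<omega>) * indicator F (X \<omega>) \<partial>P)"
proof -
  have f': "f \<in> borel_measurable (restrict_space (distr P borel X) F)"
    using f measurable_cong_sets[OF sets_restrict_space_cong[OF sets_distr[of P borel X]] refl] by blast
  have "(\<lambda>x. f x * indicator F x) \<in> borel_measurable borel"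
    using f F borel_measurable_restrict_space_iff_ennreal[of F borel f] by simp
  then show ?thesis
    using f' F X unfolding scaled_law_def
    by (simp add: nn_integral_scale_measure nn_integral_restrict_space nn_integral_distr)
qed

section \<open>Uniqueness of vague limits on the cone\<close>

text \<open>For finite y a continuous function that is positive exactly above y; products of ramps
  turn half-spaces and level sets into cozero sets.\<close>

definition ramp :: "ennreal \<Rightarrow> ennreal \<Rightarrow> real" where
  "ramp y s = enn2real (min 1 (s - y))"

lemma ramp_nonneg: "0 \<le> ramp y s"
  by (simp add: ramp_def)

text \<open>In \<^typ>\<open>ennreal\<close>, \<open>\<infinity> - \<infinity> = \<infinity>\<close>; hence the assumption \<open>y < \<infinity>\<close>.\<close>

lemma ramp_pos_iff:
  assumes "y < \<infinity>"
  shows "0 < ramp y s \<longleftrightarrow> y < s"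
proof -
  have "min 1 (s - y) < top" by (auto simp: min_less_iff_disj)
  then have "0 < ramp y s \<longleftrightarrow> 0 < min 1 (s - y)"
    by (simp add: ramp_def enn2real_positive_iff)
  also have "\<dots> \<longleftrightarrow> y < s"
    using diff_gr0_ennreal[of y s] diff_eq_0_ennreal[of s y] assms
    by (cases "y < s") (auto simp: not_less intro: le_less_trans)
  finally show ?thesis .
qed

lemma continuous_on_ramp:
  assumes "continuous_on F \<rho>" "y < \<infinity>"
  shows "continuous_on F (\<lambda>x. ramp y (\<rho> x))"
  unfolding continuous_on_def ramp_def
proof
  fix x assume "x \<in> F"
  have "((\<lambda>x. min 1 (\<rho> x - y)) \<longlongrightarrow> min 1 (\<rho> x - y)) (at x within F)"
    using assms \<open>x \<in> F\<close> unfolding continuous_on_def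
    by (intro tendsto_min tendsto_const tendsto_diff_ennreal_general) auto
  then show "((\<lambda>x. enn2real (min 1 (\<rho> x - y))) \<longlongrightarrow> enn2real (min 1 (\<rho> x - y))) (at x within F)"
    by (intro tendsto_enn2real) (auto simp: min_less_iff_disj)
qed

lemma Cc_plus_mult:
  assumes f: "f \<in> Cc_plus F" and g: "continuous_on F g" "\<And>x. x \<in> F \<Longrightarrow> 0 \<le> g x"
  shows "(\<lambda>x. f x * g x) \<in> Cc_plus F"
  using f g by (intro Cc_plus_subsupport[OF f]) (auto simp: Cc_plus_def intro: continuous_on_mult)

text \<open>The functions min 1 (n g) are again test functions and increase to the indicator of {g >
  0}, so monotone convergence carries equality of integrals over to measures of sets.\<close>

lemma emeasure_cozero_eq:
  fixes F :: "'x::topological_space set"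
  assumes \<mu>: "\<mu> \<in> radon_measures F" and \<nu>: "\<nu> \<in> radon_measures F"
    and eq: "\<And>f. f \<in> Cc_plus F \<Longrightarrow> (\<integral>\<^sup>+ x. ennreal (f x) \<partial>\<mu>) = (\<integral>\<^sup>+ x. ennreal (f x) \<partial>\<nu>)"
    and g: "g \<in> Cc_plus F"
  shows "emeasure \<mu> {x \<in> F. 0 < g x} = emeasure \<nu> {x \<in> F. 0 < g x}"
proof -
  define f where "f n x = min 1 (real n * g x)" for n x
  have g': "continuous_on F g" "\<And>x. x \<in> F \<Longrightarrow> 0 \<le> g x"
    using g by (auto simp: Cc_plus_def)
  have f: "f n \<in> Cc_plus F" for n
  proof (rule Cc_plus_subsupport[OF g])
    show "continuous_on F (f n)"
      unfolding f_def by (intro continuous_intros g')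
  qed (use g' in \<open>auto simp: f_def\<close>)
  have "emeasure \<kappa> {x \<in> F. 0 < g x} = (SUP n. \<integral>\<^sup>+ x. ennreal (f n x) \<partial>\<kappa>)"
    if \<kappa>: "\<kappa> \<in> radon_measures F" for \<kappa>
  proof -
    note [measurable] = radon_measures_measurable[OF \<kappa> g'(1)]
    have sp: "space \<kappa> = F" using space_radon_measures[OF \<kappa>] .
    have "{x \<in> space \<kappa>. 0 < g x} \<in> sets \<kappa>" by measurable
    then have "emeasure \<kappa> {x \<in> F. 0 < g x} = (\<integral>\<^sup>+ x. indicator {x \<in> F. 0 < g x} x \<partial>\<kappa>)"
      using sp by simp
    also have "\<dots> = (\<integral>\<^sup>+ x. (SUP n. ennreal (f n x)) \<partial>\<kappa>)"
    proof (intro nn_integral_cong antisym)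
      fix x assume "x \<in> space \<kappa>"
      then have x: "x \<in> F" using sp by simp
      show "(SUP n. ennreal (f n x)) \<le> indicator {x \<in> F. 0 < g x} x"
      proof (rule SUP_least)
        show "ennreal (f n x) \<le> indicator {x \<in> F. 0 < g x} x" for n
          using x g'(2)[OF x] by (cases "g x = 0") (auto simp: f_def less_le)
      qed
      show "indicator {x \<in> F. 0 < g x} x \<le> (SUP n. ennreal (f n x))"
      proof (cases "0 < g x")
        case True
        then obtain n where "1 < real n * g x" using reals_Archimedean3 by blast
        then have "f n x = 1" by (simp add: f_def)
        then show ?thesis by (intro SUP_upper2[of n]) (auto simp: indicator_def)
      qed simp
    qed
    also have "\<dots> = (SUP n. \<integral>\<^sup>+ x. ennreal (f n x) \<partial>\<kappa>)"
    proof (rule nn_integral_monotone_convergence_SUP_AE)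
      show "AE x in \<kappa>. ennreal (f n x) \<le> ennreal (f (Suc n) x)" for n
      proof (intro AE_I2 ennreal_leI)
        fix x assume "x \<in> space \<kappa>"
        then have "real n * g x \<le> real (Suc n) * g x"
          using g'(2) sp by (intro mult_right_mono) auto
        then show "f n x \<le> f (Suc n) x"
          unfolding f_def by (rule min.mono[OF order_refl])
      qed
      show "(\<lambda>x. ennreal (f n x)) \<in> borel_measurable \<kappa>" for n
        unfolding f_def by measurable
    qed
    finally show ?thesis .
  qed
  then show ?thesis using \<mu> \<nu> eq[OF f] by simp
qed

text \<open>The cozero sets of test functions are stable under intersection, since the product of
  two test functions is one. They generate the Borel sets of the cone, and countably many of finite
  mass exhaust it.\<close>

lemma radon_measures_cone_E_eqI:
  fixes \<mu> \<nu> :: "('d::finite \<Rightarrow> ennreal) measure"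
  assumes l: "1 \<le> l" "l \<le> CARD('d)"
    and \<mu>: "\<mu> \<in> radon_measures (cone_E l)" and \<nu>: "\<nu> \<in> radon_measures (cone_E l)"
    and eq: "\<And>f. f \<in> Cc_plus (cone_E l) \<Longrightarrow> (\<integral>\<^sup>+ x. ennreal (f x) \<partial>\<mu>) = (\<integral>\<^sup>+ x. ennreal (f x) \<partial>\<nu>)"
  shows "\<mu> = \<nu>"
proof -
  let ?E = "cone_E l :: ('d \<Rightarrow> ennreal) set"
  let ?G = "(\<lambda>g. {x \<in> ?E. 0 < g x}) ` Cc_plus ?E"
  let ?r = "\<lambda>n. ramp (ennreal (1 / Suc n))"
  have cozeroI: "{x \<in> ?E. 0 < g x} \<in> ?G" if "g \<in> Cc_plus ?E" for g
    using that by blast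
  have r_pos: "0 < ?r n s \<longleftrightarrow> ennreal (1 / Suc n) < s" for n s
    by (rule ramp_pos_iff) simp
  have r_Cc: "(\<lambda>x. ?r n (kth_largest l x)) \<in> Cc_plus ?E" for n
  proof (rule Cc_plusI)
    show "compact {x \<in> ?E. ennreal (1 / Suc n) \<le> kth_largest l x}"
      "closed {x \<in> ?E. ennreal (1 / Suc n) \<le> kth_largest l x}"
      by (rule compact_cone_E_level[OF l]; simp)+
    show "continuous_on ?E (\<lambda>x. ?r n (kth_largest l x))"
      by (intro continuous_on_ramp continuous_on_kth_largest l) simp
    show "x \<in> {x \<in> ?E. ennreal (1 / Suc n) \<le> kth_largest l x}"
      if "x \<in> ?E" "?r n (kth_largest l x) \<noteq> 0" for x
      using that r_pos[of n "kth_largest l x"] ramp_nonneg[of "ennreal (1 / Suc n)" "kth_largest l x"] by auto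
  qed (auto simp: ramp_nonneg)
  let ?A = "\<lambda>n. {x \<in> ?E. 0 < ?r n (kth_largest l x)}"
  have UN_A: "(\<Union>n. ?A n) = ?E"
  proof -
    have "\<exists>n. ennreal (1 / Suc n) < kth_largest l x" if "x \<in> ?E" for x
      using that UN_Ioi_inverse_Suc by (auto simp: cone_E_iff set_eq_iff)
    then show ?thesis unfolding r_pos by auto
  qed
  have G_Pow: "?G \<subseteq> Pow ?E" by auto
  have sets_eq: "sets (restrict_space borel ?E) = sigma_sets ?E ?G"
  proof (rule antisym)
    have "{x \<in> ?E. 0 < g x} \<in> sets (restrict_space borel ?E)" if "g \<in> Cc_plus ?E" for g
    proof -
      have "g \<in> borel_measurable (restrict_space borel ?E)"
        using that by (intro borel_measurable_continuous_on_restrict) (simp add: Cc_plus_def)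
      then have "{x \<in> space (restrict_space borel ?E). 0 < g x} \<in> sets (restrict_space borel ?E)"
        by measurable
      then show ?thesis by (simp add: space_restrict_space)
    qed
    then have "sigma_sets (space (restrict_space borel ?E)) ?G \<subseteq> sets (restrict_space borel ?E)"
      by (intro sets.sigma_sets_subset) auto
    then show "sigma_sets ?E ?G \<subseteq> sets (restrict_space borel ?E)"
      by (simp add: space_restrict_space)
    have "(\<lambda>x. x i) \<in> borel_measurable (sigma ?E ?G)" for i
    proof (rule borel_measurableI_greater)
      fix y :: ennreal
      show "{x \<in> space (sigma ?E ?G). y < x i} \<in> sets (sigma ?E ?G)"
      proof (cases "y = \<infinity>")
        case False
        \<comment> \<open>The first factor supplies the compact support, the second selects
          \<open>y < x i\<close>; the union over n then removes the restriction on the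
          radius.\<close>
        let ?g = "\<lambda>n x. ?r n (kth_largest l x) * ramp y (x i)"
        have "?g n \<in> Cc_plus ?E" for n
          using False continuous_on_subset[OF continuous_on_product_coordinates[of i]]
          by (intro Cc_plus_mult r_Cc continuous_on_ramp) (auto simp: ramp_nonneg less_le)
        then have "(\<Union>n. {x \<in> ?E. 0 < ?g n x}) \<in> sets (sigma ?E ?G)"
          using G_Pow by (intro sets.countable_UN) (auto intro!: sigma_sets.Basic cozeroI)
        moreover have "(\<Union>n. {x \<in> ?E. 0 < ?g n x}) = {x \<in> ?E. y < x i}"
        proof -
          have "0 < ?g n x \<longleftrightarrow> 0 < ?r n (kth_largest l x) \<and> y < x i" for n x
            using ramp_nonneg[of "ennreal (1 / Suc n)" "kth_largest l x"] ramp_nonneg[of y "x i"]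
              ramp_pos_iff[of y "x i"] False by (auto simp: zero_less_mult_iff less_le)
          moreover have "\<exists>n. 0 < ?r n (kth_largest l x)" if "x \<in> ?E" for x
          proof -
            have "x \<in> (\<Union>n. ?A n)" using that by (simp only: UN_A)
            then show ?thesis by auto
          qed
          ultimately show ?thesis by auto
        qed
        ultimately show ?thesis using G_Pow by (simp add: space_measure_of)
      qed simp
    qed
    then have "(\<lambda>x. x) \<in> borel_measurable (sigma ?E ?G)"
      by (rule measurable_coordinatewise_then_product)
    then have "(\<lambda>x. x) \<in> measurable (sigma ?E ?G) (restrict_space borel ?E)"
      using G_Pow by (intro measurable_restrict_space2) (auto simp: space_measure_of)
    from measurable_sets[OF this]
    show "sets (restrict_space borel ?E) \<subseteq> sigma_sets ?E ?G"
      using G_Pow sets.sets_into_space[of _ "restrict_space borel ?E"]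
      by (auto simp: space_restrict_space space_measure_of Int_absorb2)
  qed
  show ?thesis
  proof (rule measure_eqI_generator_eq[where E = ?G and \<Omega> = ?E and A = ?A])
    show "Int_stable ?G"
    proof (rule Int_stableI)
      fix a b assume "a \<in> ?G" "b \<in> ?G"
      then obtain f g where fg: "f \<in> Cc_plus ?E" "g \<in> Cc_plus ?E"
        and ab: "a = {x \<in> ?E. 0 < f x}" "b = {x \<in> ?E. 0 < g x}" by auto
      have "a \<inter> b = {x \<in> ?E. 0 < f x * g x}"
        using fg by (fastforce simp: ab Cc_plus_def zero_less_mult_iff)
      moreover have "(\<lambda>x. f x * g x) \<in> Cc_plus ?E"
        using fg by (intro Cc_plus_mult) (auto simp: Cc_plus_def)
      ultimately show "a \<inter> b \<in> ?G" using cozeroI[of "\<lambda>x. f x * g x"] by simp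
    qed
    show "emeasure \<mu> X = emeasure \<nu> X" if "X \<in> ?G" for X
      using that emeasure_cozero_eq[OF \<mu> \<nu> eq] by auto
    show "range ?A \<subseteq> ?G"
      using cozeroI[OF r_Cc] by blast
    show "emeasure \<mu> (?A n) \<noteq> \<infinity>" for n
    proof -
      let ?K = "{x \<in> ?E. ennreal (1 / Suc n) \<le> kth_largest l x}"
      have K: "compact ?K" "closed ?K" by (rule compact_cone_E_level[OF l]; simp)+
      have "?K \<in> sets (restrict_space borel ?E)"
        using sets_cone_E[OF l] K(2) by (subst sets_restrict_space_iff) auto
      then have "emeasure \<mu> (?A n) \<le> emeasure \<mu> ?K"
        using \<mu> unfolding r_pos by (intro emeasure_mono) (auto simp: radon_measures_def intro: less_imp_le)
      also have "\<dots> < \<infinity>"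
        using \<mu> K by (auto simp: radon_measures_def)
      finally show ?thesis by simp
    qed
    show "sets \<mu> = sigma_sets ?E ?G" "sets \<nu> = sigma_sets ?E ?G"
      using \<mu> \<nu> sets_eq by (auto simp: radon_measures_def)
  qed (use G_Pow UN_A in auto)
qed

section \<open>The cone measure of a probability measure on the sphere\<close>

definition sphere_prob :: "nat \<Rightarrow> ('d::finite \<Rightarrow> ennreal) measure \<Rightarrow> bool" where
  "sphere_prob l S \<longleftrightarrow> prob_space S \<and> sets S = sets (restrict_space borel (delta_aleph l))"

lemma sphere_probD:
  assumes "sphere_prob l S"
  shows "space S = delta_aleph l" "emeasure S (delta_aleph l) = 1" "sigma_finite_measure S"
proof -
  interpret prob_space S using assms by (simp add: sphere_prob_def)
  show sp: "space S = delta_aleph l"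
    using assms by (auto simp: sphere_prob_def space_restrict_space dest: sets_eq_imp_space_eq)
  show "emeasure S (delta_aleph l) = 1"
    using emeasure_space_1 sp by simp
  show "sigma_finite_measure S" by unfold_locales
qed

lemma sets_pareto_pair:
  assumes "\<alpha> > 0" "sphere_prob l S"
  shows "sets (pareto_measure \<alpha> \<Otimes>\<^sub>M S) = sets (restrict_space borel ({0<..} \<times> delta_aleph l))"
  using sets_pair_measure_cong[OF sets_pareto[OF assms(1)], of S "restrict_space borel (delta_aleph l)"] assms(2)
  by (simp add: sphere_prob_def restrict_borel_Times)

lemma emeasure_pareto_pair:
  assumes \<alpha>: "\<alpha> > 0" and S: "sphere_prob l S"
    and "A \<in> sets (restrict_space borel {0<..})" "\<Lambda> \<in> sets (restrict_space borel (delta_aleph l))"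
  shows "emeasure (pareto_measure \<alpha> \<Otimes>\<^sub>M S) (A \<times> \<Lambda>) = emeasure (pareto_measure \<alpha>) A * emeasure S \<Lambda>"
  using assms(3,4) S sets_pareto[OF \<alpha>] sphere_probD(3)[OF S]
  by (intro sigma_finite_measure.emeasure_pair_measure_Times) (auto simp: sphere_prob_def)

lemma Ici_in_sets: "r > 0 \<Longrightarrow> {ennreal r..} \<in> sets (restrict_space borel {0<..})"
  by (subst sets_restrict_space_iff) (auto intro: less_le_trans[of 0 "ennreal r"])

lemma top_in_sets: "{\<infinity>} \<in> sets (restrict_space borel ({0<..} :: ennreal set))"
  by (subst sets_restrict_space_iff) auto

lemma emeasure_pareto_finite_Ici:
  assumes "\<alpha> > 0" "r > 0"
  shows "emeasure (pareto_measure \<alpha>) ({ennreal r..} - {\<infinity>}) = ennreal (r powr - \<alpha>)"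
  using assms emeasure_pareto_top Ici_in_sets top_in_sets
  by (subst emeasure_Diff_null_set) (auto simp: emeasure_pareto_Ici null_sets_def sets_pareto)

lemma delta_aleph_in_sets:
  "delta_aleph l \<in> sets (restrict_space borel (delta_aleph l))"
  using sets.top[of "restrict_space borel (delta_aleph l)"] by (simp add: space_restrict_space)

text \<open>On a compact set the radius is bounded below by some r > 0, so the set lies in a strip
  of finite mass.\<close>

lemma pareto_pair_radon:
  assumes l: "1 \<le> l" "l \<le> CARD('d::finite)" and \<alpha>: "\<alpha> > 0" and S: "sphere_prob l (S :: ('d \<Rightarrow> ennreal) measure)"
  shows "pareto_measure \<alpha> \<Otimes>\<^sub>M S \<in> radon_measures ({0<..} \<times> delta_aleph l)"
  unfolding radon_measures_def
proof (intro CollectI conjI allI impI sets_pareto_pair[OF \<alpha> S])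
  fix K :: "(ennreal \<times> ('d \<Rightarrow> ennreal)) set" assume K: "compact K \<and> K \<subseteq> {0<..} \<times> delta_aleph l"
  then obtain r where r: "r > 0" "\<And>p. p \<in> K \<Longrightarrow> ennreal r \<le> fst p"
    by (rule_tac compact_radius_pos[of K fst]) (auto intro: continuous_on_fst continuous_on_id)
  have "emeasure (pareto_measure \<alpha> \<Otimes>\<^sub>M S) K \<le> emeasure (pareto_measure \<alpha> \<Otimes>\<^sub>M S) ({ennreal r..} \<times> delta_aleph l)"
    using K r(2) Ici_in_sets[OF r(1)] delta_aleph_in_sets[of l] S
    by (intro emeasure_mono pair_measureI) (auto simp: sets_pareto[OF \<alpha>] sphere_prob_def)
  also have "\<dots> = ennreal (r powr - \<alpha>)"
    using Ici_in_sets[OF r(1)] r(1) sphere_probD(2)[OF S]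
    by (subst emeasure_pareto_pair[OF \<alpha> S]) (auto simp: emeasure_pareto_Ici[OF \<alpha>] delta_aleph_in_sets)
  finally show "emeasure (pareto_measure \<alpha> \<Otimes>\<^sub>M S) K < \<infinity>"
    by (rule le_less_trans) simp
qed

lemma emeasure_pareto_pair_top:
  assumes "\<alpha> > 0" "sphere_prob l (S :: ('d::finite \<Rightarrow> ennreal) measure)"
  shows "emeasure (pareto_measure \<alpha> \<Otimes>\<^sub>M S) {p \<in> {0<..} \<times> delta_aleph l. fst p = \<infinity>} = 0"
proof -
  have "{p \<in> {0<..} \<times> delta_aleph l. fst p = \<infinity>} = {\<infinity> :: ennreal} \<times> (delta_aleph l :: ('d \<Rightarrow> ennreal) set)" by auto
  then show ?thesis
    using emeasure_pareto_pair[OF assms top_in_sets delta_aleph_in_sets] emeasure_pareto_top[OF assms(1)]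
    by simp
qed

definition cone_measure ::
    "nat \<Rightarrow> real \<Rightarrow> ('d::finite \<Rightarrow> ennreal) measure \<Rightarrow> ('d \<Rightarrow> ennreal) measure" where
  "cone_measure l \<alpha> S = distr (pareto_measure \<alpha> \<Otimes>\<^sub>M S) (restrict_space borel (cone_E l)) unpolar_map"

lemma measurable_unpolar_pair:
  assumes "1 \<le> l" "l \<le> CARD('d::finite)" "\<alpha> > 0" "sphere_prob l (S :: ('d \<Rightarrow> ennreal) measure)"
  shows "unpolar_map \<in> measurable (pareto_measure \<alpha> \<Otimes>\<^sub>M S) (restrict_space borel (cone_E l))"
  using measurable_unpolar_map[OF assms(1,2)] measurable_cong_sets[OF sets_pareto_pair[OF assms(3,4)] refl]
  by blast

lemma space_pareto_pair: "\<alpha> > 0 \<Longrightarrow> sphere_prob l S \<Longrightarrow> space (pareto_measure \<alpha> \<Otimes>\<^sub>M S) = {0<..} \<times> delta_aleph l"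
  by (simp add: space_pair_measure space_pareto sphere_probD)

lemma emeasure_cone_measure:
  assumes "1 \<le> l" "l \<le> CARD('d::finite)" "\<alpha> > 0" "sphere_prob l (S :: ('d \<Rightarrow> ennreal) measure)"
    and "A \<in> sets (restrict_space borel (cone_E l))"
  shows "emeasure (cone_measure l \<alpha> S) A =
    emeasure (pareto_measure \<alpha> \<Otimes>\<^sub>M S) {p \<in> {0<..} \<times> delta_aleph l. unpolar_map p \<in> A}"
  unfolding cone_measure_def emeasure_distr[OF measurable_unpolar_pair[OF assms(1-4)] assms(5)]
    space_pareto_pair[OF assms(3,4)] by (intro arg_cong[where f="emeasure _"]) auto

lemma sets_polar_preimage:
  assumes "1 \<le> l" "l \<le> CARD('d::finite)"
    and "A \<in> sets (restrict_space borel {0<..})" "\<Lambda> \<in> sets (restrict_space borel (delta_aleph l))"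
  shows "{x \<in> cone_E l :: ('d \<Rightarrow> ennreal) set. polar_map l x \<in> A \<times> \<Lambda>} \<in> sets (restrict_space borel (cone_E l))"
proof -
  have "A \<times> \<Lambda> \<in> sets (restrict_space borel ({0<..} \<times> delta_aleph l))"
    using pair_measureI[OF assms(3,4)] by (simp add: restrict_borel_Times)
  from measurable_sets[OF measurable_polar_map[OF assms(1,2)] this]
  show ?thesis by (simp add: space_restrict_space vimage_def Int_def conj_commute)
qed

text \<open>Taking \<infinity> out of the radii keeps the artificial value of
  \<open>polar_map\<close> away, so that a sector is a preimage of a rectangle.\<close>

lemma polar_sector_eq:
  "{x \<in> cone_E l. kth_largest l x \<ge> r \<and> kth_largest l x < \<infinity> \<and> (\<lambda>i. x i / kth_largest l x) \<in> \<Lambda>} =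
   {x \<in> cone_E l. polar_map l x \<in> ({r..} - {\<infinity>}) \<times> \<Lambda>}"
  by (auto simp: polar_map_def)

text \<open>At finite radius \<open>polar_map\<close> inverts \<open>unpolar_map\<close>, so the
  preimage of the sector is a rectangle, and leaving out \<infinity> costs no Pareto mass. The
  relation in the theorem is this formula once \<nu> is known to be the cone measure of S.\<close>

lemma emeasure_cone_measure_sector:
  assumes l: "1 \<le> l" "l \<le> CARD('d::finite)" and \<alpha>: "\<alpha> > 0" and S: "sphere_prob l (S :: ('d \<Rightarrow> ennreal) measure)"
    and r: "r > 0" and \<Lambda>: "\<Lambda> \<in> sets (restrict_space borel (delta_aleph l))"
  shows "emeasure (cone_measure l \<alpha> S)
      {x \<in> cone_E l. kth_largest l x \<ge> ennreal r \<and> kth_largest l x < \<infinity> \<and> (\<lambda>i. x i / kth_largest l x) \<in> \<Lambda>} =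
    ennreal (r powr - \<alpha>) * emeasure S \<Lambda>"
proof -
  let ?A = "{ennreal r..} - {\<infinity>}"
  have A: "?A \<in> sets (restrict_space borel {0<..})"
    by (intro sets.Diff Ici_in_sets r top_in_sets)
  have "\<Lambda> \<subseteq> delta_aleph l" "?A \<subseteq> {0<..}"
    using sets.sets_into_space[OF \<Lambda>] sets.sets_into_space[OF A] by (auto simp: space_restrict_space)
  then have "{p \<in> {0<..} \<times> delta_aleph l. unpolar_map p \<in> {x \<in> cone_E l. polar_map l x \<in> ?A \<times> \<Lambda>}} = ?A \<times> \<Lambda>"
  proof (intro equalityI subsetI)
    fix p assume p: "p \<in> {p \<in> {0<..} \<times> delta_aleph l. unpolar_map p \<in> {x \<in> cone_E l. polar_map l x \<in> ?A \<times> \<Lambda>}}"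
    then have "fst p \<in> ?A"
      using kth_largest_unpolar_map[OF l, of p] fst_polar_map[of l "unpolar_map p"] by (auto simp: mem_Times_iff)
    then have "fst p < \<infinity>" by (simp add: less_le)
    then show "p \<in> ?A \<times> \<Lambda>" using polar_unpolar_map[OF l, of p] p by simp
  next
    fix p assume p: "p \<in> ?A \<times> \<Lambda>"
    then have "p \<in> {0<..} \<times> delta_aleph l" "fst p < \<infinity>"
      using \<open>\<Lambda> \<subseteq> delta_aleph l\<close> \<open>?A \<subseteq> {0<..}\<close> by (auto simp: less_le)
    then show "p \<in> {p \<in> {0<..} \<times> delta_aleph l. unpolar_map p \<in> {x \<in> cone_E l. polar_map l x \<in> ?A \<times> \<Lambda>}}"
      using polar_unpolar_map[OF l, of p] unpolar_map_in[OF l, of p] p by simp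
  qed
  then show ?thesis
    using emeasure_pareto_pair[OF \<alpha> S A \<Lambda>] emeasure_pareto_finite_Ici[OF \<alpha> r]
    unfolding polar_sector_eq emeasure_cone_measure[OF l \<alpha> S sets_polar_preimage[OF l A \<Lambda>]] by simp
qed

lemma level_in_sets:
  assumes l: "1 \<le> l" "l \<le> CARD('d::finite)" and "0 < r"
  shows "{x \<in> cone_E l :: ('d \<Rightarrow> ennreal) set. ennreal r \<le> kth_largest l x} \<in> sets (restrict_space borel (cone_E l))"
  using sets_cone_E[OF l] compact_cone_E_level(2)[OF l \<open>0 < r\<close>] by (subst sets_restrict_space_iff) auto

text \<open>\<open>unpolar_map\<close> preserves the radius even when it is infinite, so the
  preimage is a full strip. The case r = 1 is the normalization; general r shows that compact sets
  have finite mass.\<close>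

lemma emeasure_cone_measure_level:
  assumes l: "1 \<le> l" "l \<le> CARD('d::finite)" and \<alpha>: "\<alpha> > 0" and S: "sphere_prob l (S :: ('d \<Rightarrow> ennreal) measure)"
    and r: "r > 0"
  shows "emeasure (cone_measure l \<alpha> S) {x \<in> cone_E l. ennreal r \<le> kth_largest l x} = ennreal (r powr - \<alpha>)"
proof -
  have "{p \<in> {0<..} \<times> delta_aleph l. unpolar_map p \<in> {x \<in> cone_E l. ennreal r \<le> kth_largest l x}} =
      {ennreal r..} \<times> (delta_aleph l :: ('d \<Rightarrow> ennreal) set)"
  proof (intro equalityI subsetI)
    fix p :: "ennreal \<times> ('d \<Rightarrow> ennreal)" assume p: "p \<in> {p \<in> {0<..} \<times> delta_aleph l. unpolar_map p \<in> {x \<in> cone_E l. ennreal r \<le> kth_largest l x}}"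
    then show "p \<in> {ennreal r..} \<times> delta_aleph l"
      using kth_largest_unpolar_map[OF l, of p] by (auto simp: mem_Times_iff)
  next
    fix p :: "ennreal \<times> ('d \<Rightarrow> ennreal)" assume p: "p \<in> {ennreal r..} \<times> delta_aleph l"
    then have "p \<in> {0<..} \<times> delta_aleph l"
      using less_le_trans[of 0 "ennreal r" "fst p"] r by (auto simp: mem_Times_iff)
    then show "p \<in> {p \<in> {0<..} \<times> delta_aleph l. unpolar_map p \<in> {x \<in> cone_E l. ennreal r \<le> kth_largest l x}}"
      using kth_largest_unpolar_map[OF l, of p] unpolar_map_in[OF l, of p] p by (auto simp: mem_Times_iff)
  qed
  then show ?thesis
    using emeasure_pareto_pair[OF \<alpha> S Ici_in_sets[OF r] delta_aleph_in_sets] sphere_probD(2)[OF S]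
      emeasure_pareto_Ici[OF \<alpha> r]
    by (simp add: emeasure_cone_measure[OF l \<alpha> S level_in_sets[OF l r]])
qed

lemma aleph_eq_level: "aleph l = {x \<in> cone_E l. ennreal 1 \<le> kth_largest l x}"
  by (simp add: aleph_def)

lemma cone_measure_radon:
  assumes l: "1 \<le> l" "l \<le> CARD('d::finite)" and \<alpha>: "\<alpha> > 0" and S: "sphere_prob l (S :: ('d \<Rightarrow> ennreal) measure)"
  shows "cone_measure l \<alpha> S \<in> radon_measures (cone_E l)"
  unfolding radon_measures_def
proof (intro CollectI conjI allI impI)
  show sets: "sets (cone_measure l \<alpha> S) = sets (restrict_space borel (cone_E l))"
    by (simp add: cone_measure_def)
  fix K :: "('d \<Rightarrow> ennreal) set" assume K: "compact K \<and> K \<subseteq> cone_E l"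
  then obtain r where r: "r > 0" "\<And>p. p \<in> K \<Longrightarrow> ennreal r \<le> kth_largest l p"
    by (rule_tac compact_radius_pos[of K "kth_largest l"])
      (auto intro: continuous_on_kth_largest[OF l] simp: cone_E_iff)
  have "emeasure (cone_measure l \<alpha> S) K \<le> emeasure (cone_measure l \<alpha> S) {x \<in> cone_E l. ennreal r \<le> kth_largest l x}"
    using K r(2) level_in_sets[OF l r(1)] sets by (intro emeasure_mono) auto
  then show "emeasure (cone_measure l \<alpha> S) K < \<infinity>"
    unfolding emeasure_cone_measure_level[OF l \<alpha> S r(1)] by (rule le_less_trans) simp
qed

text \<open>Dividing the radius acts on rectangles through the Pareto factor alone, and rectangles
  determine the product.\<close>

lemma emeasure_pareto_pair_divide:
  assumes l: "1 \<le> l" "l \<le> CARD('d::finite)" and \<alpha>: "\<alpha> > 0" and S: "sphere_prob l (S :: ('d \<Rightarrow> ennreal) measure)"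
    and c: "c > 0" and B: "B \<in> sets (pareto_measure \<alpha> \<Otimes>\<^sub>M S)"
  shows "emeasure (pareto_measure \<alpha> \<Otimes>\<^sub>M S) {p \<in> {0<..} \<times> delta_aleph l. (fst p / ennreal c, snd p) \<in> B} =
    ennreal (c powr - \<alpha>) * emeasure (pareto_measure \<alpha> \<Otimes>\<^sub>M S) B"
proof -
  let ?PS = "pareto_measure \<alpha> \<Otimes>\<^sub>M S" and ?D = "\<lambda>p. (fst p / ennreal c, snd p)"
  let ?k = "c powr - \<alpha>"
  have k: "ennreal (inverse ?k) * ennreal ?k = 1"
    using c by (simp add: ennreal_mult'[symmetric])
  have div: "(\<lambda>s. s / ennreal c) \<in> measurable (pareto_measure \<alpha>) (pareto_measure \<alpha>)"
    using measurable_divide_Ioi[OF c] measurable_cong_sets[OF sets_pareto[OF \<alpha>] sets_pareto[OF \<alpha>]] by blast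
  have D: "?D \<in> measurable ?PS ?PS"
    using div by (intro measurable_Pair measurable_compose[OF measurable_fst div] measurable_snd)
  have rect: "emeasure (distr ?PS ?PS ?D) (A \<times> L) = ennreal ?k * (emeasure (pareto_measure \<alpha>) A * emeasure S L)"
    if A: "A \<in> sets (pareto_measure \<alpha>)" and L: "L \<in> sets S" for A L
  proof -
    let ?A = "(\<lambda>s. s / ennreal c) -` A \<inter> space (pareto_measure \<alpha>)"
    have "?D -` (A \<times> L) \<inter> space ?PS = ?A \<times> L"
      using sets.sets_into_space[OF L] by (auto simp: space_pair_measure)
    then have "emeasure (distr ?PS ?PS ?D) (A \<times> L) = emeasure ?PS (?A \<times> L)"
      using D A L by (subst emeasure_distr) auto
    also have "\<dots> = emeasure (pareto_measure \<alpha>) ?A * emeasure S L"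
      using measurable_sets[OF div A] L S by (intro emeasure_pareto_pair[OF \<alpha> S]) (auto simp: sets_pareto[OF \<alpha>] sphere_prob_def)
    also have "emeasure (pareto_measure \<alpha>) ?A =
        emeasure (distr (pareto_measure \<alpha>) (restrict_space borel {0<..}) (\<lambda>s. s / ennreal c)) A"
      using A div measurable_cong_sets[OF refl sets_pareto[OF \<alpha>]]
      by (subst emeasure_distr) (auto simp: sets_pareto[OF \<alpha>])
    also have "\<dots> = ennreal ?k * emeasure (pareto_measure \<alpha>) A"
      unfolding distr_pareto_divide[OF \<alpha> c] by simp
    finally show ?thesis by (simp add: mult.assoc)
  qed
  \<comment> \<open>Agreement on rectangles identifies a measure with the product itself, so the
    image is first divided by its factor.\<close>
  have "?PS = scale_measure (ennreal (inverse ?k)) (distr ?PS ?PS ?D)"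
  proof (rule pair_measure_eqI[OF sigma_finite_pareto[OF \<alpha>] sphere_probD(3)[OF S]])
    show "emeasure (pareto_measure \<alpha>) A * emeasure S L =
        emeasure (scale_measure (ennreal (inverse ?k)) (distr ?PS ?PS ?D)) (A \<times> L)"
      if "A \<in> sets (pareto_measure \<alpha>)" "L \<in> sets S" for A L
      using k by (simp add: rect[OF that] mult.assoc[symmetric])
  qed simp
  then have "emeasure ?PS B = emeasure (scale_measure (ennreal (inverse ?k)) (distr ?PS ?PS ?D)) B"
    by (rule arg_cong[where f="\<lambda>M. emeasure M B"])
  also have "\<dots> = ennreal (inverse ?k) * emeasure (distr ?PS ?PS ?D) B"
    by (rule emeasure_scale_measure)
  finally have "ennreal ?k * emeasure ?PS B = (ennreal (inverse ?k) * ennreal ?k) * emeasure (distr ?PS ?PS ?D) B"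
    by (simp only: mult_ac)
  also have "\<dots> = emeasure (distr ?PS ?PS ?D) B"
    by (simp only: k mult_1_left)
  also have "\<dots> = emeasure ?PS (?D -` B \<inter> space ?PS)"
    by (rule emeasure_distr[OF D B])
  also have "?D -` B \<inter> space ?PS = {p \<in> {0<..} \<times> delta_aleph l. ?D p \<in> B}"
    unfolding space_pareto_pair[OF \<alpha> S] by auto
  finally show ?thesis by simp
qed

text \<open>A dilation is rewritten as a preimage under division, to which measurability and
  image-measure formulas apply.\<close>

lemma image_scale_cone_E:
  fixes A :: "('d::finite \<Rightarrow> ennreal) set"
  assumes l: "1 \<le> l" "l \<le> CARD('d)" and "A \<subseteq> cone_E l" and c: "c > 0"
  shows "(\<lambda>x i. ennreal c * x i) ` A = {x \<in> cone_E l. (\<lambda>i. x i / ennreal c) \<in> A}"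
proof -
  note cancel = ennreal_mult_divide_cancel[of "ennreal c"]
  show ?thesis
  proof (intro equalityI subsetI)
    fix y assume "y \<in> (\<lambda>x i. ennreal c * x i) ` A"
    then obtain x where x: "x \<in> A" "y = (\<lambda>i. ennreal c * x i)" by auto
    then show "y \<in> {x \<in> cone_E l. (\<lambda>i. x i / ennreal c) \<in> A}"
      using assms(3) c cancel by (auto simp: cone_E_iff kth_largest_mult[OF l] ennreal_zero_less_mult_iff)
  next
    fix y assume y: "y \<in> {x \<in> cone_E l. (\<lambda>i. x i / ennreal c) \<in> A}"
    then show "y \<in> (\<lambda>x i. ennreal c * x i) ` A"
      using c cancel by (intro image_eqI[of _ _ "\<lambda>i. y i / ennreal c"]) auto
  qed
qed

lemma cone_measure_scale:
  assumes l: "1 \<le> l" "l \<le> CARD('d::finite)" and \<alpha>: "\<alpha> > 0" and S: "sphere_prob l (S :: ('d \<Rightarrow> ennreal) measure)"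
    and c: "c > 0" and A: "A \<in> sets (cone_measure l \<alpha> S)"
  shows "emeasure (cone_measure l \<alpha> S) ((\<lambda>x i. ennreal c * x i) ` A) =
    ennreal (c powr - \<alpha>) * emeasure (cone_measure l \<alpha> S) A"
proof -
  have A: "A \<in> sets (restrict_space borel (cone_E l))" using A by (simp add: cone_measure_def)
  then have AE: "A \<subseteq> cone_E l"
    using sets.sets_into_space by (fastforce simp: space_restrict_space)
  let ?B = "{p \<in> {0<..} \<times> delta_aleph l. unpolar_map p \<in> A}"
  let ?A' = "{x \<in> cone_E l. (\<lambda>i. x i / ennreal c) \<in> A}"
  have B: "?B \<in> sets (pareto_measure \<alpha> \<Otimes>\<^sub>M S)"
    using measurable_sets[OF measurable_unpolar_pair[OF l \<alpha> S] A] unfolding space_pareto_pair[OF \<alpha> S]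
    by (simp add: vimage_def Int_def conj_commute)
  have "(\<lambda>x i. x i / ennreal c) \<in> measurable (restrict_space borel (cone_E l))
      (restrict_space borel (cone_E l :: ('d \<Rightarrow> ennreal) set))"
  proof (rule measurable_restrict_space3)
    show "(\<lambda>x i. x i / ennreal c) \<in> borel_measurable (borel :: ('d \<Rightarrow> ennreal) measure)"
      by (intro measurable_coordinatewise_then_product borel_measurable_divide_ennreal
        borel_measurable_coordinate measurable_const) simp
  qed (auto simp: cone_E_iff kth_largest_divide[OF l] ennreal_zero_less_divide)
  from measurable_sets[OF this A] have A': "?A' \<in> sets (restrict_space borel (cone_E l))"
    by (simp add: space_restrict_space vimage_def Int_def conj_commute)
  \<comment> \<open>Dividing a point by c divides its radius and leaves its direction alone.\<close>
  have "{p \<in> {0<..} \<times> delta_aleph l. unpolar_map p \<in> ?A'} =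
      {p \<in> {0<..} \<times> delta_aleph l. (fst p / ennreal c, snd p) \<in> ?B}"
  proof -
    have "(\<lambda>i. unpolar_map p i / ennreal c) = unpolar_map (fst p / ennreal c, snd p)"
      for p :: "ennreal \<times> ('d \<Rightarrow> ennreal)"
      by (auto simp: unpolar_map_def divide_ennreal_def mult_ac)
    then show ?thesis
      using unpolar_map_in[OF l] by (auto simp: ennreal_zero_less_divide)
  qed
  then show ?thesis
    unfolding image_scale_cone_E[OF l AE c] emeasure_cone_measure[OF l \<alpha> S A']
      emeasure_cone_measure[OF l \<alpha> S A]
    using emeasure_pareto_pair_divide[OF l \<alpha> S c B] by simp
qed

section \<open>The spectral measure of a homogeneous measure\<close>

abbreviation sector :: "nat \<Rightarrow> ennreal \<Rightarrow> ('d::finite \<Rightarrow> ennreal) set \<Rightarrow> ('d \<Rightarrow> ennreal) set" where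
  "sector l r \<Lambda> \<equiv>
    {x \<in> cone_E l. kth_largest l x \<ge> r \<and> kth_largest l x < \<infinity> \<and> (\<lambda>i. x i / kth_largest l x) \<in> \<Lambda>}"

text \<open>The distribution of the direction under \<nu> on radii in [1,\<infinity>). Infinite
  radii are left out because \<open>polar_map\<close> gives them an artificial direction.\<close>

definition spectral_measure :: "nat \<Rightarrow> ('d::finite \<Rightarrow> ennreal) measure \<Rightarrow> ('d \<Rightarrow> ennreal) measure" where
  "spectral_measure l \<nu> = distr (restrict_space \<nu> (sector l 1 (delta_aleph l)))
     (restrict_space borel (delta_aleph l)) (snd \<circ> polar_map l)"

definition homogeneous :: "real \<Rightarrow> ('d \<Rightarrow> ennreal) measure \<Rightarrow> bool" where
  "homogeneous \<alpha> \<nu> \<longleftrightarrow> (\<forall>c>0. \<forall>A\<in>sets \<nu>.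
     emeasure \<nu> ((\<lambda>x i. ennreal c * x i) ` A) = ennreal (c powr - \<alpha>) * emeasure \<nu> A)"

lemma sector_in_sets:
  assumes l: "1 \<le> l" "l \<le> CARD('d::finite)" and r: "r > 0"
    and \<Lambda>: "(\<Lambda> :: ('d \<Rightarrow> ennreal) set) \<in> sets (restrict_space borel (delta_aleph l))"
  shows "sector l (ennreal r) \<Lambda> \<in> sets (restrict_space borel (cone_E l))"
  unfolding polar_sector_eq
  by (intro sets_polar_preimage l \<Lambda> sets.Diff Ici_in_sets r top_in_sets)

lemma top_level_in_sets:
  assumes l: "1 \<le> l" "l \<le> CARD('d::finite)"
  shows "{x \<in> cone_E l. kth_largest l x = \<infinity>} \<in> sets (restrict_space borel (cone_E l :: ('d \<Rightarrow> ennreal) set))"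
proof -
  have "kth_largest l \<in> borel_measurable (restrict_space borel (cone_E l :: ('d \<Rightarrow> ennreal) set))"
    by (intro measurable_restrict_space1 borel_measurable_kth_largest l)
  then have "{x \<in> space (restrict_space borel (cone_E l)). kth_largest l x = \<infinity>} \<in>
      sets (restrict_space borel (cone_E l :: ('d \<Rightarrow> ennreal) set))"
    by measurable
  then show ?thesis by (simp add: space_restrict_space)
qed

context
  fixes l :: nat and \<alpha> :: real and \<nu> :: "('d::finite \<Rightarrow> ennreal) measure"
  assumes l: "1 \<le> l" "l \<le> CARD('d)" and \<alpha>: "\<alpha> > 0"
    and radon: "\<nu> \<in> radon_measures (cone_E l)" and hom: "homogeneous \<alpha> \<nu>"
    and norm: "emeasure \<nu> (aleph l) = 1"
begin

lemma emeasure_scale: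
  "c > 0 \<Longrightarrow> A \<in> sets \<nu> \<Longrightarrow>
    emeasure \<nu> ((\<lambda>x i. ennreal c * x i) ` A) = ennreal (c powr - \<alpha>) * emeasure \<nu> A"
  using hom by (simp add: homogeneous_def)

lemma emeasure_top_level: "emeasure \<nu> {x \<in> cone_E l. kth_largest l x = \<infinity>} = 0"
proof -
  let ?A = "{x \<in> cone_E l :: ('d \<Rightarrow> ennreal) set. kth_largest l x = \<infinity>}"
  have A: "?A \<in> sets \<nu>" unfolding sets_radon_measures[OF radon] by (rule top_level_in_sets[OF l])
  \<comment> \<open>The factor 2 stands for any dilation other than the identity; all of them fix
    the infinite level.\<close>
  have "(\<lambda>x i. ennreal 2 * x i) ` ?A = {x \<in> cone_E l. (\<lambda>i. x i / ennreal 2) \<in> ?A}"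
    by (rule image_scale_cone_E[OF l]) auto
  also have "\<dots> = ?A"
  proof (intro Collect_cong conj_cong refl)
    fix x :: "'d \<Rightarrow> ennreal" assume "x \<in> cone_E l"
    then show "(\<lambda>i. x i / ennreal 2) \<in> ?A \<longleftrightarrow> kth_largest l x = \<infinity>"
      by (cases "kth_largest l x")
        (auto simp: cone_E_iff kth_largest_divide[OF l] divide_ennreal ennreal_top_divide simp del: ennreal_numeral)
  qed
  \<comment> \<open>A scale-invariant set of finite measure is null by homogeneity.\<close>
  finally have image: "(\<lambda>x i. ennreal 2 * x i) ` ?A = ?A" .
  have "emeasure \<nu> ?A = ennreal (2 powr - \<alpha>) * emeasure \<nu> ?A"
    using emeasure_scale[of 2, OF _ A] unfolding image by linarith
  \<comment> \<open>The normalization bounds the mass by 1, which rules out \<infinity> as a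
    solution of the scaling equation.\<close>
  moreover have "emeasure \<nu> ?A \<le> emeasure \<nu> (aleph l)"
    using level_in_sets[OF l, of 1] unfolding aleph_eq_level by (intro emeasure_mono) (auto simp: sets_radon_measures[OF radon])
  then have "emeasure \<nu> ?A \<noteq> \<infinity>" unfolding norm by (auto simp: top_unique)
  then obtain m where m: "emeasure \<nu> ?A = ennreal m" "m \<ge> 0" by (cases "emeasure \<nu> ?A") auto
  ultimately have "m = 2 powr - \<alpha> * m"
    by (simp add: ennreal_mult'[symmetric])
  moreover have "2 powr - \<alpha> < 1" using \<alpha> by (simp add: powr_less_one)
  ultimately have "m = 0" by auto
  then show ?thesis using m by simp
qed

text \<open>Dilation by r multiplies the radius and fixes the direction, so it carries the sector at
  level 1 onto the sector at level r.\<close>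

lemma emeasure_sector:
  assumes r: "r > 0" and \<Lambda>: "\<Lambda> \<in> sets (restrict_space borel (delta_aleph l))"
  shows "emeasure \<nu> (sector l (ennreal r) \<Lambda>) = ennreal (r powr - \<alpha>) * emeasure \<nu> (sector l 1 \<Lambda>)"
proof -
  let ?A = "sector l 1 \<Lambda>"
  have A: "?A \<in> sets \<nu>" using sector_in_sets[OF l _ \<Lambda>, of 1] by (simp add: sets_radon_measures[OF radon])
  have "(\<lambda>x i. ennreal r * x i) ` ?A = {x \<in> cone_E l. (\<lambda>i. x i / ennreal r) \<in> ?A}"
    by (rule image_scale_cone_E[OF l _ r]) auto
  also have "\<dots> = sector l (ennreal r) \<Lambda>"
  proof (intro Collect_cong conj_cong refl)
    fix x :: "'d \<Rightarrow> ennreal" assume x: "x \<in> cone_E l"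
    note cancel = ennreal_mult_divide_cancel[of "ennreal r"]
    have le: "1 \<le> kth_largest l x / ennreal r \<longleftrightarrow> ennreal r \<le> kth_largest l x"
    proof
      assume "1 \<le> kth_largest l x / ennreal r"
      from mult_left_mono[OF this, of "ennreal r"] show "ennreal r \<le> kth_largest l x"
        using cancel(2)[of "kth_largest l x"] r by simp
    next
      assume "ennreal r \<le> kth_largest l x"
      from divide_right_mono_ennreal[OF this, of "ennreal r"] show "1 \<le> kth_largest l x / ennreal r"
        using cancel(3) r by simp
    qed
    \<comment> \<open>The radius is finite here, but a single coordinate may still be \<infinity>;
      hence the case distinction on it.\<close>
    have ratio: "(\<lambda>i. x i / ennreal r / (kth_largest l x / ennreal r)) = (\<lambda>i. x i / kth_largest l x)"
      if fin: "kth_largest l x < \<infinity>"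
    proof -
      obtain k where k: "kth_largest l x = ennreal k" "k > 0"
        using fin x by (cases "kth_largest l x") (auto simp: cone_E_iff)
      have "a / ennreal r / (ennreal k / ennreal r) = a / ennreal k" for a
        using r k(2) by (cases a) (auto simp: divide_ennreal ennreal_top_divide field_simps)
      then show ?thesis by (simp add: k)
    qed
    have pos: "(\<lambda>i. x i / ennreal r) \<in> cone_E l" and fin: "kth_largest l x / ennreal r < \<infinity> \<longleftrightarrow> kth_largest l x < \<infinity>"
      using x r by (cases "kth_largest l x";
          auto simp: cone_E_iff kth_largest_divide[OF l] divide_ennreal ennreal_top_divide)+
    show "(\<lambda>i. x i / ennreal r) \<in> ?A \<longleftrightarrow>
        ennreal r \<le> kth_largest l x \<and> kth_largest l x < \<infinity> \<and> (\<lambda>i. x i / kth_largest l x) \<in> \<Lambda>"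
      using pos le fin ratio by (auto simp: kth_largest_divide[OF l])
  qed
  finally have "(\<lambda>x i. ennreal r * x i) ` ?A = sector l (ennreal r) \<Lambda>" .
  with emeasure_scale[OF r A] show ?thesis by (simp only:)
qed

lemma sector_one_in_sets:
  "\<Lambda> \<in> sets (restrict_space borel (delta_aleph l)) \<Longrightarrow> sector l 1 \<Lambda> \<in> sets \<nu>"
  using sector_in_sets[OF l, of 1 \<Lambda>] by (simp add: sets_radon_measures[OF radon])

lemma emeasure_spectral_measure:
  assumes \<Lambda>: "\<Lambda> \<in> sets (restrict_space borel (delta_aleph l))"
  shows "emeasure (spectral_measure l \<nu>) \<Lambda> = emeasure \<nu> (sector l 1 \<Lambda>)"
proof -
  let ?A = "sector l 1 (delta_aleph l)"
  have A: "?A \<in> sets \<nu>" by (rule sector_one_in_sets[OF delta_aleph_in_sets])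
  have "snd \<in> measurable (restrict_space borel ({0<..} :: ennreal set) \<Otimes>\<^sub>M restrict_space borel (delta_aleph l))
      (restrict_space borel (delta_aleph l :: ('d \<Rightarrow> ennreal) set))"
    by (rule measurable_snd)
  then have "snd \<in> measurable (restrict_space borel (({0<..} :: ennreal set) \<times> delta_aleph l))
      (restrict_space borel (delta_aleph l :: ('d \<Rightarrow> ennreal) set))"
    unfolding measurable_cong_sets[OF restrict_borel_Times refl] .
  from measurable_comp[OF measurable_polar_map[OF l] this]
  have "snd \<circ> polar_map l \<in> measurable \<nu> (restrict_space borel (delta_aleph l))"
    unfolding measurable_cong_sets[OF sets_radon_measures[OF radon] refl] .
  then have meas: "snd \<circ> polar_map l \<in> measurable (restrict_space \<nu> ?A) (restrict_space borel (delta_aleph l))"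
    by (rule measurable_restrict_space1)
  have sub: "\<Lambda> \<subseteq> delta_aleph l" using sets.sets_into_space[OF \<Lambda>] by (simp add: space_restrict_space)
  have "(snd \<circ> polar_map l) -` \<Lambda> \<inter> space (restrict_space \<nu> ?A) = sector l 1 \<Lambda>"
    using sub by (auto simp: space_restrict_space space_radon_measures[OF radon] polar_map_def)
  then show ?thesis
    unfolding spectral_measure_def emeasure_distr[OF meas \<Lambda>]
    using A sub by (subst emeasure_restrict_space) auto
qed

text \<open>The total mass is that of \<open>aleph l\<close> without the infinite level, which is
  null, so the normalization of \<nu> makes it 1.\<close>

lemma sphere_prob_spectral_measure: "sphere_prob l (spectral_measure l \<nu>)"
  unfolding sphere_prob_def
proof
  show sets: "sets (spectral_measure l \<nu>) = sets (restrict_space borel (delta_aleph l))"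
    by (simp add: spectral_measure_def)
  have sp: "space (spectral_measure l \<nu>) = delta_aleph l"
    by (simp add: spectral_measure_def space_restrict_space)
  let ?T = "{x \<in> cone_E l :: ('d \<Rightarrow> ennreal) set. kth_largest l x = \<infinity>}"
  have "sector l 1 (delta_aleph l) = aleph l - ?T"
  proof (intro set_eqI)
    fix x :: "'d \<Rightarrow> ennreal"
    have "kth_largest l x / kth_largest l x = 1" if "x \<in> cone_E l" "kth_largest l x < \<infinity>"
      using that ennreal_mult_divide_cancel(3) by (simp add: cone_E_iff)
    then show "x \<in> sector l 1 (delta_aleph l) \<longleftrightarrow> x \<in> aleph l - ?T"
      by (cases "kth_largest l x") (auto simp: aleph_def delta_aleph_iff kth_largest_divide[OF l])
  qed
  moreover have "emeasure \<nu> (aleph l - ?T) = emeasure \<nu> (aleph l)"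
    using level_in_sets[OF l, of 1] top_level_in_sets[OF l] emeasure_top_level
    by (intro emeasure_Diff_null_set) (auto simp: sets_radon_measures[OF radon] aleph_eq_level null_sets_def)
  ultimately have "emeasure (spectral_measure l \<nu>) (delta_aleph l) = 1"
    using norm by (simp add: emeasure_spectral_measure[OF delta_aleph_in_sets])
  then show "prob_space (spectral_measure l \<nu>)"
    by (intro prob_spaceI) (simp add: sp)
qed

text \<open>The preimage contains the whole infinite level as soon as \<Lambda> contains the
  artificial direction; being null, that level does not disturb the formula for sectors.\<close>

lemma emeasure_polar_Ici:
  assumes r: "r > 0" and \<Lambda>: "\<Lambda> \<in> sets (restrict_space borel (delta_aleph l))"
  shows "emeasure \<nu> {x \<in> cone_E l. polar_map l x \<in> {ennreal r..} \<times> \<Lambda>} =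
    ennreal (r powr - \<alpha>) * emeasure (spectral_measure l \<nu>) \<Lambda>"
proof -
  let ?T = "{x \<in> cone_E l :: ('d \<Rightarrow> ennreal) set. kth_largest l x = \<infinity>}"
  let ?H = "{x \<in> cone_E l. polar_map l x \<in> {ennreal r..} \<times> \<Lambda>}"
  have "sector l (ennreal r) \<Lambda> = ?H - ?T"
    unfolding polar_sector_eq by (auto simp: mem_Times_iff fst_polar_map)
  moreover have "emeasure \<nu> (?H - ?T) = emeasure \<nu> ?H"
    using sets_polar_preimage[OF l Ici_in_sets[OF r] \<Lambda>] top_level_in_sets[OF l] emeasure_top_level
    by (intro emeasure_Diff_null_set) (auto simp: sets_radon_measures[OF radon] null_sets_def)
  ultimately show ?thesis
    using emeasure_sector[OF r \<Lambda>] by (simp add: emeasure_spectral_measure[OF \<Lambda>])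
qed

text \<open>Open tails are the form in which a multiple of the Pareto measure is recognized. They
  follow from closed tails at s > r by letting s decrease to r.\<close>

lemma emeasure_polar_Ioi:
  assumes r: "r > 0" and \<Lambda>: "\<Lambda> \<in> sets (restrict_space borel (delta_aleph l))"
  shows "emeasure \<nu> {x \<in> cone_E l. polar_map l x \<in> {ennreal r<..} \<times> \<Lambda>} =
    emeasure (spectral_measure l \<nu>) \<Lambda> * ennreal (r powr - \<alpha>)"
    (is "emeasure \<nu> ?H = ?S * _")
proof (rule antisym)
  have "emeasure \<nu> ?H \<le> emeasure \<nu> {x \<in> cone_E l. polar_map l x \<in> {ennreal r..} \<times> \<Lambda>}"
    using sets_polar_preimage[OF l Ici_in_sets[OF r] \<Lambda>] by (intro emeasure_mono) (auto simp: sets_radon_measures[OF radon])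
  then show "emeasure \<nu> ?H \<le> ?S * ennreal (r powr - \<alpha>)"
    unfolding emeasure_polar_Ici[OF r \<Lambda>] by (simp add: mult.commute)
  have "?S * ennreal (s powr - \<alpha>) \<le> emeasure \<nu> ?H" if "s > r" for s
  proof -
    have "{ennreal s..} \<subseteq> {ennreal r<..}"
      using that r by (auto elim!: less_le_trans[rotated] intro!: ennreal_lessI)
    then have "emeasure \<nu> {x \<in> cone_E l. polar_map l x \<in> {ennreal s..} \<times> \<Lambda>} \<le> emeasure \<nu> ?H"
      using sets_polar_preimage[OF l Ioi_in_sets[of r] \<Lambda>] by (intro emeasure_mono) (auto simp: sets_radon_measures[OF radon])
    then show ?thesis
      using emeasure_polar_Ici[OF _ \<Lambda>, of s] that r by (simp add: mult.commute)
  qed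
  then have "eventually (\<lambda>s. ?S * ennreal (s powr - \<alpha>) \<le> emeasure \<nu> ?H) (at_right r)"
    by (auto simp: eventually_at_right_field intro!: exI[of _ "r + 1"])
  moreover have "((\<lambda>s. ?S * ennreal (s powr - \<alpha>)) \<longlongrightarrow> ?S * ennreal (r powr - \<alpha>)) (at_right r)"
  proof (rule ennreal_tendsto_cmult)
    \<comment> \<open>A finite factor is needed for multiplication by it to preserve the
      limit.\<close>
    have "?S \<le> emeasure (spectral_measure l \<nu>) (delta_aleph l)"
      using delta_aleph_in_sets[of l] sets.sets_into_space[OF \<Lambda>]
      by (intro emeasure_mono) (auto simp: spectral_measure_def space_restrict_space)
    then show "?S < top"
      unfolding sphere_probD(2)[OF sphere_prob_spectral_measure] by (rule le_less_trans) simp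
    show "((\<lambda>s. ennreal (s powr - \<alpha>)) \<longlongrightarrow> ennreal (r powr - \<alpha>)) (at_right r)"
      using r by (intro tendsto_ennrealI tendsto_intros) auto
  qed
  ultimately show "?S * ennreal (r powr - \<alpha>) \<le> emeasure \<nu> ?H"
    by (intro tendsto_upperbound) auto
qed

text \<open>The polar factorization of \<nu>. It is enough to compare rectangles, and for fixed
  \<Lambda> that is an identity between two measures of the radius.\<close>

lemma distr_polar_map:
  "pareto_measure \<alpha> \<Otimes>\<^sub>M spectral_measure l \<nu> =
    distr \<nu> (restrict_space borel ({0<..} \<times> delta_aleph l)) (polar_map l)"
proof (rule pair_measure_eqI[OF sigma_finite_pareto[OF \<alpha>] sphere_probD(3)[OF sphere_prob_spectral_measure]])
  let ?R = "restrict_space borel ({0<..} \<times> delta_aleph l) :: (ennreal \<times> ('d \<Rightarrow> ennreal)) measure"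
  show "sets (pareto_measure \<alpha> \<Otimes>\<^sub>M spectral_measure l \<nu>) = sets (distr \<nu> ?R (polar_map l))"
    by (simp add: sets_pareto_pair[OF \<alpha> sphere_prob_spectral_measure])
  have T: "polar_map l \<in> measurable \<nu> ?R"
    using measurable_polar_map[OF l] measurable_cong_sets[OF sets_radon_measures[OF radon] refl] by blast
  fix A \<Lambda> assume A: "A \<in> sets (pareto_measure \<alpha>)" and "\<Lambda> \<in> sets (spectral_measure l \<nu>)"
  then have \<Lambda>: "\<Lambda> \<in> sets (restrict_space borel (delta_aleph l))"
    by (simp add: spectral_measure_def)
  have rect: "emeasure (distr \<nu> ?R (polar_map l)) (B \<times> \<Lambda>) = emeasure \<nu> {x \<in> cone_E l. polar_map l x \<in> B \<times> \<Lambda>}"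
    if "B \<in> sets (restrict_space borel {0<..})" for B
  proof -
    have "B \<times> \<Lambda> \<in> sets ?R"
      using pair_measureI[OF that \<Lambda>] by (simp add: restrict_borel_Times)
    then show ?thesis
      by (subst emeasure_distr[OF T]) (auto simp: space_radon_measures[OF radon] intro!: arg_cong[where f="emeasure \<nu>"])
  qed
  \<comment> \<open>The radial measure over the fixed directions \<Lambda>. Its tails are
    \<open>emeasure_polar_Ioi\<close>, which makes it a multiple of the Pareto measure.\<close>
  define \<kappa> where "\<kappa> = distr (restrict_space (distr \<nu> ?R (polar_map l)) ({0<..} \<times> \<Lambda>)) (restrict_space borel {0<..}) fst"
  have sub: "\<Lambda> \<subseteq> delta_aleph l" using sets.sets_into_space[OF \<Lambda>] by (simp add: space_restrict_space)
  have fst: "fst \<in> measurable ?R (restrict_space borel ({0<..} :: ennreal set))"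
    using measurable_fst[of "restrict_space borel ({0<..} :: ennreal set)" "restrict_space borel (delta_aleph l :: ('d \<Rightarrow> ennreal) set)"]
    unfolding measurable_cong_sets[OF restrict_borel_Times refl] .
  have strip: "{0<..} \<times> \<Lambda> \<in> sets ?R"
    using pair_measureI[OF sets.top[of "restrict_space borel ({0<..} :: ennreal set)"] \<Lambda>]
    by (simp add: restrict_borel_Times space_restrict_space)
  have \<kappa>: "emeasure \<kappa> B = emeasure (distr \<nu> ?R (polar_map l)) (B \<times> \<Lambda>)"
    if B: "B \<in> sets (restrict_space borel {0<..})" for B
  proof -
    have "fst \<in> measurable (restrict_space (distr \<nu> ?R (polar_map l)) ({0<..} \<times> \<Lambda>)) (restrict_space borel {0<..})"
      using fst by (intro measurable_restrict_space1) simp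
    then have "emeasure \<kappa> B = emeasure (restrict_space (distr \<nu> ?R (polar_map l)) ({0<..} \<times> \<Lambda>))
        (fst -` B \<inter> space (restrict_space (distr \<nu> ?R (polar_map l)) ({0<..} \<times> \<Lambda>)))"
      unfolding \<kappa>_def using B by (subst emeasure_distr) auto
    also have "fst -` B \<inter> space (restrict_space (distr \<nu> ?R (polar_map l)) ({0<..} \<times> \<Lambda>)) = B \<times> \<Lambda>"
      using sub sets.sets_into_space[OF B] by (auto simp: space_restrict_space)
    finally show ?thesis
      using strip sets.sets_into_space[OF B] sets.Int_space_eq2[OF strip]
      by (subst (asm) emeasure_restrict_space) (auto simp: space_restrict_space)
  qed
  have "\<kappa> = scale_measure (emeasure (spectral_measure l \<nu>) \<Lambda>) (pareto_measure \<alpha>)"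
  proof (rule eq_scale_pareto[OF \<alpha>])
    show "emeasure \<kappa> {ennreal r<..} = emeasure (spectral_measure l \<nu>) \<Lambda> * ennreal (r powr - \<alpha>)" if "r > 0" for r
      by (simp only: \<kappa>[OF Ioi_in_sets] rect[OF Ioi_in_sets] emeasure_polar_Ioi[OF that \<Lambda>])
    have "emeasure (spectral_measure l \<nu>) \<Lambda> \<le> emeasure (spectral_measure l \<nu>) (delta_aleph l)"
      using delta_aleph_in_sets[of l] sub by (intro emeasure_mono) (auto simp: spectral_measure_def)
    then show "emeasure (spectral_measure l \<nu>) \<Lambda> < \<infinity>"
      unfolding sphere_probD(2)[OF sphere_prob_spectral_measure] by (rule le_less_trans) simp
  qed (simp add: \<kappa>_def)
  then have "emeasure \<kappa> A = emeasure (spectral_measure l \<nu>) \<Lambda> * emeasure (pareto_measure \<alpha>) A"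
    by simp
  then show "emeasure (pareto_measure \<alpha>) A * emeasure (spectral_measure l \<nu>) \<Lambda> =
      emeasure (distr \<nu> ?R (polar_map l)) (A \<times> \<Lambda>)"
    using \<kappa> A by (simp add: sets_pareto[OF \<alpha>] mult.commute)
qed

end

section \<open>Transfer of vague convergence\<close>

text \<open>Finite coordinates keep the radius finite, so the artificial value of
  \<open>polar_map\<close> never occurs and the scaling factor cancels from the ratio. At radius 0
  both memberships fail.\<close>

lemma polar_map_scaled:
  fixes z :: "'d::finite \<Rightarrow> ennreal"
  assumes l: "1 \<le> l" "l \<le> CARD('d)" and fin: "\<forall>i. z i < \<infinity>" and c: "c > 0"
  shows "(\<lambda>i. z i / ennreal c) \<in> cone_E l \<longleftrightarrow>
      (kth_largest l z / ennreal c, \<lambda>i. z i / kth_largest l z) \<in> {0<..} \<times> delta_aleph l" (is ?thesis1)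
    and "(\<lambda>i. z i / ennreal c) \<in> cone_E l \<Longrightarrow> kth_largest l (\<lambda>i. z i / ennreal c) < \<infinity>" (is "?X \<Longrightarrow> ?thesis2")
    and "(\<lambda>i. z i / ennreal c) \<in> cone_E l \<Longrightarrow>
      polar_map l (\<lambda>i. z i / ennreal c) = (kth_largest l z / ennreal c, \<lambda>i. z i / kth_largest l z)" (is "?X \<Longrightarrow> ?thesis3")
proof -
  obtain k where k: "kth_largest l z = ennreal k" "k \<ge> 0"
    using kth_largest_less_top[OF l fin] by (cases "kth_largest l z") auto
  have kth: "kth_largest l (\<lambda>i. z i / ennreal c) = ennreal (k / c)"
    using c k by (simp add: kth_largest_divide[OF l] divide_ennreal)
  then show fin': ?thesis2 by simp
  have ratio: "z i / ennreal c / (ennreal k / ennreal c) = z i / ennreal k" if "k > 0" for i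
    using c that fin[rule_format, of i] by (cases "z i") (auto simp: divide_ennreal field_simps)
  have polar: ?thesis3 if ?X
  proof -
    have "k > 0" using that c kth by (auto simp: cone_E_iff zero_less_divide_iff)
    then show ?thesis
      using ratio c k(2) by (simp add: polar_map_def kth k(1) divide_ennreal)
  qed
  then show "?X \<Longrightarrow> ?thesis3" .
  show ?thesis1
  proof
    assume ?X
    then show "(kth_largest l z / ennreal c, \<lambda>i. z i / kth_largest l z) \<in> {0<..} \<times> delta_aleph l"
      using polar_map_in[OF l] polar by metis
  next
    assume "(kth_largest l z / ennreal c, \<lambda>i. z i / kth_largest l z) \<in> {0<..} \<times> delta_aleph l"
    then show ?X by (simp add: cone_E_iff kth_largest_divide[OF l])
  qed
qed

context
  fixes P :: "'w measure" and Z :: "'w \<Rightarrow> 'd::finite \<Rightarrow> ennreal" and l :: nat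
    and b :: "real \<Rightarrow> real" and \<alpha> :: real
  assumes l: "1 \<le> l" "l \<le> CARD('d)" and P: "prob_space P" and Z: "Z \<in> borel_measurable P"
    and fin: "\<And>\<omega>. \<omega> \<in> space P \<Longrightarrow> \<forall>i. Z \<omega> i < \<infinity>" and b: "\<And>t. t > 0 \<Longrightarrow> b t > 0" and \<alpha>: "\<alpha> > 0"
begin

abbreviation (input) cone_law :: "real \<Rightarrow> ('d \<Rightarrow> ennreal) measure" where
  "cone_law t \<equiv> scaled_law t P (cone_E l) (\<lambda>\<omega> i. Z \<omega> i / ennreal (b t))"

abbreviation (input) polar_law :: "real \<Rightarrow> (ennreal \<times> ('d \<Rightarrow> ennreal)) measure" where
  "polar_law t \<equiv> scaled_law t P ({0<..} \<times> delta_aleph l)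
     (\<lambda>\<omega>. (kth_largest l (Z \<omega>) / ennreal (b t), \<lambda>i. Z \<omega> i / kth_largest l (Z \<omega>)))"

lemma measurable_scaled: "(\<lambda>\<omega> i. Z \<omega> i / ennreal (b t)) \<in> borel_measurable P"
  by (intro measurable_coordinatewise_then_product borel_measurable_divide_ennreal
      measurable_compose[OF Z borel_measurable_coordinate] measurable_const) simp

lemma measurable_polar_pair:
  "(\<lambda>\<omega>. (kth_largest l (Z \<omega>) / ennreal (b t), \<lambda>i. Z \<omega> i / kth_largest l (Z \<omega>))) \<in> borel_measurable P"
  unfolding borel_prod[symmetric]
  by (intro measurable_Pair measurable_coordinatewise_then_product borel_measurable_divide_ennreal
      measurable_compose[OF Z borel_measurable_coordinate]
      measurable_compose[OF Z borel_measurable_kth_largest[OF l]] measurable_const) simp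

text \<open>After pulling both sides back to P the integrands agree at every outcome, since
  membership in the two spaces is equivalent there and the polar coordinates coincide.\<close>

lemma nn_integral_polar_law:
  assumes t: "t > 0" and f: "f \<in> borel_measurable (restrict_space borel ({0<..} \<times> delta_aleph l))"
  shows "(\<integral>\<^sup>+ p. f p \<partial>polar_law t) = (\<integral>\<^sup>+ x. f (polar_map l x) \<partial>cone_law t)"
  using polar_map_scaled(1,3)[OF l fin b[OF t]]
  unfolding nn_integral_scaled_law[OF measurable_polar_pair sets_polar_space[OF l] f]
    nn_integral_scaled_law[OF measurable_scaled sets_cone_E[OF l] measurable_compose[OF measurable_polar_map[OF l] f]]
  by (intro arg_cong[where f="(*) _"] nn_integral_cong) (simp add: indicator_def)

text \<open>The converse change of variables: apply the previous one to the composition with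
  \<open>unpolar_map\<close>, which undoes \<open>polar_map\<close> at every outcome whose scaled
  value lies in the cone.\<close>

lemma nn_integral_cone_law:
  assumes t: "t > 0" and f: "f \<in> borel_measurable (restrict_space borel (cone_E l))"
  shows "(\<integral>\<^sup>+ x. f x \<partial>cone_law t) = (\<integral>\<^sup>+ p. f (unpolar_map p) \<partial>polar_law t)"
proof -
  have "unpolar_map (polar_map l (\<lambda>i. Z \<omega> i / ennreal (b t))) = (\<lambda>i. Z \<omega> i / ennreal (b t))"
    if "\<omega> \<in> space P" "(\<lambda>i. Z \<omega> i / ennreal (b t)) \<in> cone_E l" for \<omega>
    using polar_map_scaled(2)[OF l fin[OF that(1)] b[OF t]] that
    by (intro unpolar_polar_map) (auto simp: cone_E_iff)
  then show ?thesis
    unfolding nn_integral_polar_law[OF t measurable_compose[OF measurable_unpolar_map[OF l] f]]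
      nn_integral_scaled_law[OF measurable_scaled sets_cone_E[OF l] f]
      nn_integral_scaled_law[OF measurable_scaled sets_cone_E[OF l]
        measurable_compose[OF measurable_polar_map[OF l] measurable_compose[OF measurable_unpolar_map[OF l] f]]]
    by (intro arg_cong[where f="(*) _"] nn_integral_cong) (simp add: indicator_def)
qed

lemma cone_law_radon: "t > 0 \<Longrightarrow> cone_law t \<in> radon_measures (cone_E l)"
  by (intro scaled_law_radon P measurable_scaled sets_cone_E l) simp

lemma polar_law_radon: "t > 0 \<Longrightarrow> polar_law t \<in> radon_measures ({0<..} \<times> delta_aleph l)"
  by (intro scaled_law_radon P measurable_polar_pair sets_polar_space l) simp

lemma Cc_plus_borel: "f \<in> Cc_plus F \<Longrightarrow> (\<lambda>x. ennreal (f x)) \<in> borel_measurable (restrict_space borel F)"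
  by (intro measurable_compose[OF borel_measurable_continuous_on_restrict measurable_ennreal])
    (simp add: Cc_plus_def)

lemma vague_conv_polar_law:
  assumes conv: "vague_conv (cone_E l) cone_law \<nu>" and hom: "homogeneous \<alpha> \<nu>" and norm: "emeasure \<nu> (aleph l) = 1"
  shows "vague_conv ({0<..} \<times> delta_aleph l) polar_law (pareto_measure \<alpha> \<Otimes>\<^sub>M spectral_measure l \<nu>)"
proof -
  have \<nu>: "\<nu> \<in> radon_measures (cone_E l)" using conv by (simp add: vague_conv_def)
  note ctx = l \<alpha> \<nu> hom norm
  have "((\<lambda>t. \<integral>\<^sup>+ p. ennreal (f p) \<partial>polar_law t) \<longlongrightarrow>
      (\<integral>\<^sup>+ p. ennreal (f p) \<partial>(pareto_measure \<alpha> \<Otimes>\<^sub>M spectral_measure l \<nu>))) at_top"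
    if f: "f \<in> Cc_plus ({0<..} \<times> delta_aleph l)" for f
  proof -
    have f_cont: "continuous_on ({0<..} \<times> delta_aleph l) f" and f_nonneg: "\<And>p. p \<in> {0<..} \<times> delta_aleph l \<Longrightarrow> 0 \<le> f p"
      using f unfolding Cc_plus_def by blast+
    obtain C where C: "0 \<le> C" "\<And>p. p \<in> {0<..} \<times> delta_aleph l \<Longrightarrow> f p \<le> C"
      by (rule Cc_plus_bounded[OF f]) auto
    obtain r where r: "r > 0" "\<And>p. p \<in> {0<..} \<times> delta_aleph l \<Longrightarrow> f p \<noteq> 0 \<Longrightarrow> ennreal r \<le> fst p"
      by (rule Cc_plus_radius_pos[OF f, of fst]) (auto intro: continuous_on_fst continuous_on_id)
    have in_polar: "x \<in> cone_E l \<Longrightarrow> polar_map l x \<in> {0<..} \<times> delta_aleph l" for x :: "'d \<Rightarrow> ennreal"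
      by (rule polar_map_in[OF l])
    have "((\<lambda>t. \<integral>\<^sup>+ x. ennreal (f (polar_map l x)) \<partial>cone_law t) \<longlongrightarrow>
        (\<integral>\<^sup>+ x. ennreal (f (polar_map l x)) \<partial>\<nu>)) at_top"
    \<comment> \<open>The composite of \<open>f\<close> and \<open>polar_map l\<close> need not be
      continuous at infinite radius; homogeneity makes that level null for \<nu>.\<close>
    proof (rule vague_conv_tendsto_radial[OF conv continuous_on_kth_largest[OF l] compact_cone_E_level[OF l]
          emeasure_top_level[OF ctx] _ _ C(1) r(1)])
      show "ennreal r \<le> kth_largest l x" if "x \<in> cone_E l" "f (polar_map l x) \<noteq> 0" for x
        using r(2)[OF in_polar] that by (simp add: fst_polar_map)
      show "continuous_on {x \<in> cone_E l. kth_largest l x < \<infinity>} (\<lambda>x. f (polar_map l x))"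
        using in_polar by (intro continuous_on_compose2[OF f_cont continuous_on_polar_map[OF l]]) blast
      show "0 \<le> f (polar_map l x)" "f (polar_map l x) \<le> C" if "x \<in> cone_E l" for x
        using f_nonneg[OF in_polar[OF that]] C(2)[OF in_polar[OF that]] .
    qed
    also have "(\<integral>\<^sup>+ x. ennreal (f (polar_map l x)) \<partial>\<nu>) =
        (\<integral>\<^sup>+ p. ennreal (f p) \<partial>(pareto_measure \<alpha> \<Otimes>\<^sub>M spectral_measure l \<nu>))"
      using measurable_polar_map[OF l] Cc_plus_borel[OF f] measurable_cong_sets[OF sets_radon_measures[OF \<nu>] refl]
      unfolding distr_polar_map[OF ctx] by (subst nn_integral_distr) auto
    \<comment> \<open>The integrals against the two laws are known to agree for t > 0, which holds
      eventually.\<close>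
    finally show ?thesis
      by (rule Lim_transform_eventually)
        (auto intro!: eventually_mono[OF eventually_gt_at_top[of 0]] nn_integral_polar_law[symmetric] Cc_plus_borel[OF f])
  qed
  then show ?thesis
    unfolding vague_conv_def
    using polar_law_radon pareto_pair_radon[OF l \<alpha> sphere_prob_spectral_measure[OF ctx]] by blast
qed

lemma vague_conv_cone_law:
  assumes conv: "vague_conv ({0<..} \<times> delta_aleph l) polar_law (pareto_measure \<alpha> \<Otimes>\<^sub>M S)" and S: "sphere_prob l S"
  shows "vague_conv (cone_E l) cone_law (cone_measure l \<alpha> S)"
proof -
  have "((\<lambda>t. \<integral>\<^sup>+ x. ennreal (f x) \<partial>cone_law t) \<longlongrightarrow> (\<integral>\<^sup>+ x. ennreal (f x) \<partial>cone_measure l \<alpha> S)) at_top"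
    if f: "f \<in> Cc_plus (cone_E l)" for f
  proof -
    have f_cont: "continuous_on (cone_E l) f" and f_nonneg: "\<And>x. x \<in> cone_E l \<Longrightarrow> 0 \<le> f x"
      using f unfolding Cc_plus_def by blast+
    obtain C where C: "0 \<le> C" "\<And>x. x \<in> cone_E l \<Longrightarrow> f x \<le> C"
      by (rule Cc_plus_bounded[OF f]) auto
    obtain r where r: "r > 0" "\<And>x. x \<in> cone_E l \<Longrightarrow> f x \<noteq> 0 \<Longrightarrow> ennreal r \<le> kth_largest l x"
      by (rule Cc_plus_radius_pos[OF f continuous_on_kth_largest[OF l]]) (auto simp: cone_E_iff)
    have in_cone: "p \<in> {0<..} \<times> delta_aleph l \<Longrightarrow> unpolar_map p \<in> cone_E l" for p :: "ennreal \<times> ('d \<Rightarrow> ennreal)"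
      by (rule unpolar_map_in[OF l])
    have "((\<lambda>t. \<integral>\<^sup>+ p. ennreal (f (unpolar_map p)) \<partial>polar_law t) \<longlongrightarrow>
        (\<integral>\<^sup>+ p. ennreal (f (unpolar_map p)) \<partial>(pareto_measure \<alpha> \<Otimes>\<^sub>M S))) at_top"
    \<comment> \<open>The same argument on the polar space, where infinite radii are null because
      the Pareto measure does not charge \<infinity>.\<close>
    proof (rule vague_conv_tendsto_radial[OF conv continuous_on_fst[OF continuous_on_id] compact_polar_level[OF l]
          emeasure_pareto_pair_top[OF \<alpha> S] _ _ C(1) r(1)])
      show "ennreal r \<le> fst p" if "p \<in> {0<..} \<times> delta_aleph l" "f (unpolar_map p) \<noteq> 0" for p
        using r(2)[OF in_cone[OF that(1)] that(2)] kth_largest_unpolar_map[OF l that(1)] by simp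
      show "continuous_on {p \<in> {0<..} \<times> delta_aleph l. fst p < \<infinity>} (\<lambda>p. f (unpolar_map p))"
        using in_cone by (intro continuous_on_compose2[OF f_cont continuous_on_unpolar_map]) blast
      show "0 \<le> f (unpolar_map p)" "f (unpolar_map p) \<le> C" if "p \<in> {0<..} \<times> delta_aleph l" for p
        using f_nonneg[OF in_cone[OF that]] C(2)[OF in_cone[OF that]] .
    qed
    also have "(\<integral>\<^sup>+ p. ennreal (f (unpolar_map p)) \<partial>(pareto_measure \<alpha> \<Otimes>\<^sub>M S)) =
        (\<integral>\<^sup>+ x. ennreal (f x) \<partial>cone_measure l \<alpha> S)"
      unfolding cone_measure_def
      using measurable_unpolar_pair[OF l \<alpha> S] Cc_plus_borel[OF f] by (subst nn_integral_distr) auto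
    finally show ?thesis
      by (rule Lim_transform_eventually)
        (auto intro!: eventually_mono[OF eventually_gt_at_top[of 0]] nn_integral_cone_law[symmetric] Cc_plus_borel[OF f])
  qed
  then show ?thesis
    unfolding vague_conv_def using cone_law_radon cone_measure_radon[OF l \<alpha> S] by blast
qed

end

theorem proposition3p1:
  fixes P :: "'w measure"
    and Z :: "'w \<Rightarrow> 'd::finite \<Rightarrow> ennreal"
    and l :: nat
    and b :: "real \<Rightarrow> real"
    and \<alpha> :: real
  assumes "CARD('d) \<ge> 2"
    and "2 \<le> l" and "l \<le> CARD('d)"
    and "prob_space P"
    and "Z \<in> borel_measurable P"
    and "\<And>\<omega> i. \<omega> \<in> space P \<Longrightarrow> Z \<omega> i < \<infinity>"
    and "\<And>t. t > 0 \<Longrightarrow> b t > 0"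
    and "mono_on {0<..} b"
    and "filterlim b at_top at_top"
    and "\<alpha> > 0"
  shows
    "((\<exists>\<nu>. regularly_varying P Z l b \<alpha> \<nu> \<and> emeasure \<nu> (aleph l) = 1) \<longleftrightarrow>
      (\<exists>S. prob_space S \<and> sets S = sets (restrict_space borel (delta_aleph l)) \<and>
           polar_convergence P Z l b \<alpha> S)) \<and>
     (\<forall>\<nu> S.
        regularly_varying P Z l b \<alpha> \<nu> \<and> emeasure \<nu> (aleph l) = 1 \<and>
        prob_space S \<and> sets S = sets (restrict_space borel (delta_aleph l)) \<and>
        polar_convergence P Z l b \<alpha> S \<longrightarrow>
        (\<forall>r>0. \<forall>\<Lambda>\<in>sets (restrict_space borel (delta_aleph l)).
           emeasure \<nu> {x \<in> cone_E l. kth_largest l x \<ge> ennreal r \<and> kth_largest l x < \<infinity> \<and>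
                                    (\<lambda>i. x i / kth_largest l x) \<in> \<Lambda>} =
             ennreal (r powr - \<alpha>) * emeasure S \<Lambda>))"
proof -
  have l: "1 \<le> l" "l \<le> CARD('d)" using assms by auto
  have fin: "\<forall>i. Z \<omega> i < \<infinity>" if "\<omega> \<in> space P" for \<omega>
    using assms(6)[OF that] by blast
  note setting = l assms(4,5) fin assms(7)
  have rv_iff: "regularly_varying P Z l b \<alpha> \<nu> \<longleftrightarrow> \<nu> \<in> radon_measures (cone_E l) \<and> emeasure \<nu> (cone_E l) \<noteq> 0 \<and>
      homogeneous \<alpha> \<nu> \<and> vague_conv (cone_E l) (\<lambda>t. scaled_law t P (cone_E l) (\<lambda>\<omega> i. Z \<omega> i / ennreal (b t))) \<nu>" for \<nu>
    by (auto simp: regularly_varying_def homogeneous_def)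
  have to_polar: "\<exists>S. sphere_prob l S \<and> polar_convergence P Z l b \<alpha> S"
    if "regularly_varying P Z l b \<alpha> \<nu>" "emeasure \<nu> (aleph l) = 1" for \<nu>
  proof (intro exI conjI)
    have \<nu>: "\<nu> \<in> radon_measures (cone_E l)" "homogeneous \<alpha> \<nu>"
      and conv: "vague_conv (cone_E l) (\<lambda>t. scaled_law t P (cone_E l) (\<lambda>\<omega> i. Z \<omega> i / ennreal (b t))) \<nu>"
      using that(1) by (simp_all only: rv_iff)
    show "sphere_prob l (spectral_measure l \<nu>)"
      by (rule sphere_prob_spectral_measure[OF l \<open>\<alpha> > 0\<close> \<nu> that(2)])
    show "polar_convergence P Z l b \<alpha> (spectral_measure l \<nu>)"
      unfolding polar_convergence_def
      by (rule vague_conv_polar_law[OF setting \<open>\<alpha> > 0\<close> conv \<nu>(2) that(2)])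
  qed
  have to_cone: "vague_conv (cone_E l) (\<lambda>t. scaled_law t P (cone_E l) (\<lambda>\<omega> i. Z \<omega> i / ennreal (b t))) (cone_measure l \<alpha> S)"
    if "sphere_prob l S" "polar_convergence P Z l b \<alpha> S" for S
    by (rule vague_conv_cone_law[OF setting \<open>\<alpha> > 0\<close> that(2)[unfolded polar_convergence_def] that(1)])
  have from_polar: "regularly_varying P Z l b \<alpha> (cone_measure l \<alpha> S) \<and> emeasure (cone_measure l \<alpha> S) (aleph l) = 1"
    if S: "sphere_prob l S" "polar_convergence P Z l b \<alpha> S" for S
  proof -
    have one: "emeasure (cone_measure l \<alpha> S) (aleph l) = 1"
      using emeasure_cone_measure_level[OF l \<open>\<alpha> > 0\<close> S(1), of 1] by (simp add: aleph_eq_level)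
    \<comment> \<open>The limit measure is non-zero because \<open>aleph l\<close> alone has mass
      1.\<close>
    have "emeasure (cone_measure l \<alpha> S) (aleph l) \<le> emeasure (cone_measure l \<alpha> S) (space (cone_measure l \<alpha> S))"
      by (rule emeasure_space)
    then have "emeasure (cone_measure l \<alpha> S) (cone_E l) \<noteq> 0"
      using one by (auto simp: cone_measure_def space_restrict_space)
    moreover have "homogeneous \<alpha> (cone_measure l \<alpha> S)"
      using cone_measure_scale[OF l \<open>\<alpha> > 0\<close> S(1)] by (simp add: homogeneous_def)
    ultimately show ?thesis
      using one to_cone[OF S] cone_measure_radon[OF l \<open>\<alpha> > 0\<close> S(1)] by (simp add: rv_iff)
  qed
  have relation: "emeasure \<nu> (sector l (ennreal r) \<Lambda>) = ennreal (r powr - \<alpha>) * emeasure S \<Lambda>"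
    if \<nu>: "regularly_varying P Z l b \<alpha> \<nu>" and S: "sphere_prob l S" "polar_convergence P Z l b \<alpha> S"
      and r: "r > 0" and \<Lambda>: "\<Lambda> \<in> sets (restrict_space borel (delta_aleph l))" for \<nu> S r \<Lambda>
  proof -
    \<comment> \<open>S is arbitrary here and not built from \<nu>. Both measures are vague limits
      of the same scaled laws, so they have the same integrals of test functions.\<close>
    have "\<nu> = cone_measure l \<alpha> S"
    proof (rule radon_measures_cone_E_eqI[OF l])
      show "\<nu> \<in> radon_measures (cone_E l)" "cone_measure l \<alpha> S \<in> radon_measures (cone_E l)"
        using \<nu> cone_measure_radon[OF l \<open>\<alpha> > 0\<close> S(1)] by (auto simp: rv_iff)
      show "(\<integral>\<^sup>+ x. ennreal (f x) \<partial>\<nu>) = (\<integral>\<^sup>+ x. ennreal (f x) \<partial>cone_measure l \<alpha> S)"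
        if f: "f \<in> Cc_plus (cone_E l)" for f
      proof (rule tendsto_unique[OF trivial_limit_at_top_linorder])
        let ?\<mu> = "\<lambda>t. scaled_law t P (cone_E l) (\<lambda>\<omega> i. Z \<omega> i / ennreal (b t))"
        show "((\<lambda>t. \<integral>\<^sup>+ x. ennreal (f x) \<partial>?\<mu> t) \<longlongrightarrow> (\<integral>\<^sup>+ x. ennreal (f x) \<partial>\<nu>)) at_top"
          using \<nu> f by (simp add: rv_iff vague_conv_def)
        show "((\<lambda>t. \<integral>\<^sup>+ x. ennreal (f x) \<partial>?\<mu> t) \<longlongrightarrow> (\<integral>\<^sup>+ x. ennreal (f x) \<partial>cone_measure l \<alpha> S)) at_top"
          using to_cone[OF S] f by (simp add: vague_conv_def)
      qed
    qed
    then show ?thesis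
      using emeasure_cone_measure_sector[OF l \<open>\<alpha> > 0\<close> S(1) r \<Lambda>] by simp
  qed
  show ?thesis
    using to_polar from_polar relation unfolding sphere_prob_def by blast
qed

end
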